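(* Let $n,r\ge1$ and let $\boldsymbol\lambda=(\lambda_1\ge\dots\ge\lambda_r\ge0)$ be a partition of length at most $r$. Then $$\mathcal E(z,w^{-1})\Delta_{\boldsymbol\lambda}(H_r(c))=\frac{z^{r-1}}{w^{r-1}}\,\frac1{E_r(z)}\,\Delta_{\boldsymbol\lambda}(\mathbf w^{-1}(c),\overline\sigma_-(z)H_r(c)).$$
   Context: **Rings.** Let $B_0(c)=\mathbb Q[c_1,\dots,c_n]$, $c_0=1$, $c_i=0$ for $i>n$, $\mathbf c(z)=1-c_1z+\cdots+(-1)^nc_nz^n$. Let $V(c)=B_0(c)[X]$ and $X^j(c)=\sum_{i=0}^{j}(-1)^ic_iX^{j-i}$ for $j\ge0$. Let $\partial^j:V(c)\to B_0(c)$ be the $B_0(c)$-linear form with $\partial^j(X^i)=\delta_{ij}$. Let $B_r(c)=B_0(c)[e_1,\dots,e_r]$, $E_r(z)=1-e_1z+\cdots+(-1)^re_rz^r$, $\sum_{j}h_jz^j=1/E_r(z)$, and $\sum_{j\in\mathbb Z}h_j(c)z^j=\mathbf c(z)/E_r(z)\in B_r(c)[[z]]$ (so $h_j(c)=0$ for $j<0$). For a partition $\boldsymbol\lambda$ of length at most $r$ let $\Delta_{\boldsymbol\lambda}(H_r(c))=\det\big(h_{\lambda_j-j+k}(c)\big)_{1\le k,j\le r}$ ($k$ = row, $j$ = column). **Module structure.** Write $[\mathbf X(c)]^r_{\boldsymbol\lambda}=X^{r-1+\lambda_1}(c)\wedge X^{r-2+\lambda_2}(c)\wedge\cdots\wedge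 X^{\lambda_r}(c)\in\bigwedge^rV(c)$ and $[\mathbf X(c)]^r_0=X^{r-1}(c)\wedge\cdots\wedge X^0(c)$ (exterior power over $B_0(c)$). $\bigwedge^rV(c)$ is a $B_r(c)$-module in which $h_i$ acts as $\sigma_i$, where $\sigma_i(v_1\wedge\cdots\wedge v_r)=\sum_{a_1+\cdots+a_r=i,\ a_k\ge0}X^{a_1}v_1\wedge\cdots\wedge X^{a_r}v_r$; it is free of rank one generated by $[\mathbf X(c)]^r_0$, and $\Delta_{\boldsymbol\lambda}(H_r(c))\,[\mathbf X(c)]^r_0=[\mathbf X(c)]^r_{\boldsymbol\lambda}$. **The operator.** For a linear form $\partial$ on $V(c)$, $\partial\lrcorner(u_1\wedge\cdots\wedge u_r)=\sum_{k=1}^r(-1)^{k-1}\partial(u_k)\,u_1\wedge\cdots\wedge\widehat{u_k}\wedge\cdots\wedge u_r$. The $B_0(c)$-linear map $\mathcal E(z,w^{-1}):B_r(c)\to B_r(c)[[z,w^{-1}]]$ is defined by $$\big(\mathcal E(z,w^{-1})\Delta_{\boldsymbol\lambda}(H_r(c))\big)[\mathbf X(c)]^r_0=\sum_{i,j\ge0}z^iw^{-j}\,X^i\wedge\big(\partial^j\lrcorner[\mathbf X(c)]^r_{\boldsymbol\lambda}\big).$$ **The determinant.** For $m\ge0$ let $w^{-m}(c)$ be the value of the polynomial $X^m(c)$ at $X=w^{-1}$, i.e. $w^{-m}(c)=\sum_{i=0}^m(-1)^ic_iw^{-m+i}$. Put $\overline\sigma_-(z)h_j(c)=h_j(c)-h_{j-1}(c)z^{-1}$.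 Then $\Delta_{\boldsymbol\lambda}(\mathbf w^{-1}(c),\overline\sigma_-(z)H_r(c))$ is $w^{r-1}$ times the determinant of the $r\times r$ matrix whose first row is $\big(w^{-r+1-\lambda_1}(c),\,w^{-r+2-\lambda_2}(c),\dots,w^{-\lambda_r}(c)\big)$ and whose $(k,j)$ entry, for $2\le k\le r$ and $1\le j\le r$, is $\overline\sigma_-(z)h_{\lambda_j-j+k}(c)$. *)

theory Defs
  imports
    "HOL-Library.Cardinality"
    "HOL-Library.Poly_Mapping"
    "HOL-Computational_Algebra.Formal_Laurent_Series"
    "Jordan_Normal_Form.Determinant"
begin

hide_const (open) Module.smult

subsection \<open>The exterior algebra of \<open>R[X]\<close> over \<open>R\<close>\<close>

text \<open>
  Built as a quotient of the tensor algebra. A word \<open>[v\<^sub>1, \<dots>, v\<^sub>r]\<close> of polynomials is a generator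
  of the free \<open>R\<close>-module \<open>'a poly list \<Rightarrow>\<^sub>0 'a\<close>; \<open>ext_null\<close> is the submodule spanned by the
  multilinearity relations and by the words with two equal adjacent letters, i.e. the kernel of
  the projection onto the tensor algebra modulo the two-sided ideal generated by all \<open>v \<otimes> v\<close>.
\<close>

type_synonym 'a words = "'a poly list \<Rightarrow>\<^sub>0 'a"

abbreviation word :: "'a::comm_ring_1 poly list \<Rightarrow> 'a words" where
  "word vs \<equiv> Poly_Mapping.single vs 1"

definition wscale :: "'a::comm_ring_1 \<Rightarrow> 'a words \<Rightarrow> 'a words" where
  "wscale a x = Poly_Mapping.map ((*) a) x"

inductive ext_null :: "'a::comm_ring_1 words \<Rightarrow> bool" where
  zero: "ext_null 0"
| add: "ext_null x \<Longrightarrow> ext_null y \<Longrightarrow> ext_null (x + y)"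
| scale: "ext_null x \<Longrightarrow> ext_null (wscale a x)"
| lin_add: "ext_null (word (us @ (v + w) # ws) - word (us @ v # ws) - word (us @ w # ws))"
| lin_smult: "ext_null (word (us @ smult a v # ws) - wscale a (word (us @ v # ws)))"
| alt: "ext_null (word (us @ v # v # ws))"

lemma lookup_wscale [simp]: "Poly_Mapping.lookup (wscale a x) k = a * Poly_Mapping.lookup x k"
  by (simp add: wscale_def Poly_Mapping.map.rep_eq when_def)

lemma wscale_simps [simp]:
  "wscale a 0 = 0" "wscale 0 x = 0" "wscale 1 x = x"
  by (auto intro!: poly_mapping_eqI simp: algebra_simps)

lemma wscale_add: "wscale a (x + y) = wscale a x + wscale a y"
  and wscale_diff: "wscale a (x - y) = wscale a x - wscale a y"
  and wscale_add_left: "wscale (a + b) x = wscale a x + wscale b x"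
  and wscale_mult: "wscale (a * b) x = wscale a (wscale b x)"
  and wscale_uminus: "wscale (- a) x = - wscale a x"
  by (auto intro!: poly_mapping_eqI simp: algebra_simps lookup_add lookup_minus)

lemma wscale_sum: "wscale a (sum f A) = (\<Sum>i\<in>A. wscale a (f i))"
  by (induction A rule: infinite_finite_induct) (auto simp: wscale_add)

lemma ext_null_uminus: "ext_null x \<Longrightarrow> ext_null (- x)"
  using ext_null.scale[of x "-1"] by (simp add: wscale_uminus)

lemma ext_null_diff: "ext_null x \<Longrightarrow> ext_null y \<Longrightarrow> ext_null (x - y)"
  using ext_null.add[OF _ ext_null_uminus, of x y] by simp

lemma ext_null_sum: "(\<And>i. i \<in> A \<Longrightarrow> ext_null (f i)) \<Longrightarrow> ext_null (sum f A)"
  by (induction A rule: infinite_finite_induct) (auto intro: ext_null.intros)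

quotient_type (overloaded) 'a ext = "'a::comm_ring_1 words" / "\<lambda>x y. ext_null (x - y)"
proof (rule equivpI)
  show "reflp (\<lambda>x y :: 'a words. ext_null (x - y))"
    by (auto intro!: reflpI ext_null.zero)
  show "symp (\<lambda>x y :: 'a words. ext_null (x - y))"
    by (rule sympI) (use ext_null_uminus in fastforce)
  show "transp (\<lambda>x y :: 'a words. ext_null (x - y))"
    by (rule transpI) (use ext_null.add in fastforce)
qed

instantiation ext :: (comm_ring_1) ab_group_add
begin

lift_definition zero_ext :: "'a ext" is 0 .
lift_definition plus_ext :: "'a ext \<Rightarrow> 'a ext \<Rightarrow> 'a ext" is "(+)"
  using ext_null.add by (fastforce simp: algebra_simps)
lift_definition uminus_ext :: "'a ext \<Rightarrow> 'a ext" is uminus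
  using ext_null_uminus by fastforce
lift_definition minus_ext :: "'a ext \<Rightarrow> 'a ext \<Rightarrow> 'a ext" is "(-)"
  subgoal for a b c d using ext_null_diff[of "a - b" "c - d"] by (simp add: algebra_simps)
  done

instance
  by standard (transfer, simp add: ext_null.zero algebra_simps)+

end

lift_definition ext_scale :: "'a::comm_ring_1 \<Rightarrow> 'a ext \<Rightarrow> 'a ext" is wscale
  using ext_null.scale by (fastforce simp: wscale_diff[symmetric])

text \<open>\<open>wedge [v\<^sub>1, \<dots>, v\<^sub>r]\<close> is the element \<open>v\<^sub>1 \<and> \<dots> \<and> v\<^sub>r\<close>.\<close>

definition wedge :: "'a::comm_ring_1 poly list \<Rightarrow> 'a ext" where
  "wedge vs = abs_ext (word vs)"

text \<open>The \<open>r\<close>-th exterior power is the degree \<open>r\<close> part of the exterior algebra.\<close>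

definition ext_power :: "nat \<Rightarrow> 'a::comm_ring_1 ext set" where
  "ext_power r = {abs_ext x | x. \<forall>vs\<in>Poly_Mapping.keys x. length vs = r}"

subsection \<open>Linear maps given on words\<close>

definition word_ext :: "('a::comm_ring_1 poly list \<Rightarrow> 'a words) \<Rightarrow> 'a words \<Rightarrow> 'a words" where
  "word_ext f x = (\<Sum>vs\<in>Poly_Mapping.keys x. wscale (Poly_Mapping.lookup x vs) (f vs))"

lemma word_ext_superset:
  "finite A \<Longrightarrow> Poly_Mapping.keys x \<subseteq> A \<Longrightarrow>
     word_ext f x = (\<Sum>vs\<in>A. wscale (Poly_Mapping.lookup x vs) (f vs))"
  unfolding word_ext_def by (rule sum.mono_neutral_left) (auto simp: in_keys_iff)

lemma word_ext_add: "word_ext f (x + y) = word_ext f x + word_ext f y"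
proof -
  let ?A = "Poly_Mapping.keys x \<union> Poly_Mapping.keys y"
  have "Poly_Mapping.keys (x + y) \<subseteq> ?A" by (rule Poly_Mapping.keys_add)
  then show ?thesis
    by (simp add: word_ext_superset[of ?A] lookup_add wscale_add_left sum.distrib)
qed

lemma word_ext_scale: "word_ext f (wscale a x) = wscale a (word_ext f x)"
proof -
  have "Poly_Mapping.keys (wscale a x) \<subseteq> Poly_Mapping.keys x"
    by (auto simp: in_keys_iff)
  then show ?thesis
    by (simp add: word_ext_superset[of "Poly_Mapping.keys x"] wscale_sum wscale_mult)
qed

lemma word_ext_uminus: "word_ext f (- x) = - word_ext f x"
proof -
  have "- x = wscale (-1) x" by (simp add: wscale_uminus)
  then show ?thesis using word_ext_scale[of f "-1" x] by (simp add: wscale_uminus)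
qed

lemma word_ext_diff: "word_ext f (x - y) = word_ext f x - word_ext f y"
  using word_ext_add[of f x "- y"] by (simp add: word_ext_uminus)

lemma word_ext_word [simp]: "word_ext f (word vs) = f vs"
  by (simp add: word_ext_def)

lemma word_ext_null:
  assumes "ext_null x"
    and "\<And>us v w ws. ext_null (f (us @ (v + w) # ws) - f (us @ v # ws) - f (us @ w # ws))"
    and "\<And>us a v ws. ext_null (f (us @ smult a v # ws) - wscale a (f (us @ v # ws)))"
    and "\<And>us v ws. ext_null (f (us @ v # v # ws))"
  shows "ext_null (word_ext f x)"
  using assms(1)
  by induction
    (auto simp: word_ext_add word_ext_diff word_ext_scale assms(2-4)
      intro: ext_null.zero ext_null.add ext_null.scale simp: word_ext_def[of f 0])

definition wedge_left_word :: "'a::comm_ring_1 poly \<Rightarrow> 'a poly list \<Rightarrow> 'a words" where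
  "wedge_left_word u vs = word (u # vs)"

definition sigma_word :: "nat \<Rightarrow> 'a::comm_ring_1 poly list \<Rightarrow> 'a words" where
  "sigma_word i vs =
     (\<Sum>a | length a = length vs \<and> sum_list a = i.
        word (map2 (\<lambda>k v. monom 1 k * v) a vs))"

definition contract_word :: "('a::comm_ring_1 poly \<Rightarrow> 'a) \<Rightarrow> 'a poly list \<Rightarrow> 'a words" where
  "contract_word d vs =
     (\<Sum>k<length vs. wscale ((-1) ^ k * d (vs ! k)) (word (take k vs @ drop (Suc k) vs)))"

lemma wedge_left_null:
  assumes "ext_null x" shows "ext_null (word_ext (wedge_left_word u) x)"
proof (rule word_ext_null[OF assms])
  fix us v w a and ws :: "'a poly list"
  show "ext_null (wedge_left_word u (us @ (v + w) # ws) - wedge_left_word u (us @ v # ws)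
          - wedge_left_word u (us @ w # ws))"
    using ext_null.lin_add[of "u # us" v w ws] by (simp add: wedge_left_word_def)
  show "ext_null (wedge_left_word u (us @ smult a v # ws)
          - wscale a (wedge_left_word u (us @ v # ws)))"
    using ext_null.lin_smult[of "u # us" a v ws] by (simp add: wedge_left_word_def)
  show "ext_null (wedge_left_word u (us @ v # v # ws))"
    using ext_null.alt[of "u # us" v ws] by (simp add: wedge_left_word_def)
qed

lemma word_swap_null: "ext_null (word (us @ v # w # ws) + word (us @ w # v # ws))"
proof -
  let ?g = "\<lambda>p q. word (us @ p # q # ws)"
  have 1: "ext_null (?g (v + w) (v + w) - ?g v (v + w) - ?g w (v + w))"
    by (rule ext_null.lin_add)
  have 2: "ext_null (?g p (v + w) - ?g p v - ?g p w)" for p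
    using ext_null.lin_add[of "us @ [p]" v w ws] by simp
  note n = ext_null_diff[OF ext_null_diff[OF ext_null_diff[OF ext_null_diff[OF ext_null_diff[OF
    ext_null.alt[of us "v + w" ws] 1] 2[of v]] 2[of w]] ext_null.alt[of us v ws]]
    ext_null.alt[of us w ws]]
  show ?thesis using n by (simp add: algebra_simps)
qed

lemma finite_compositions: "finite {a :: nat list. length a = l \<and> sum_list a = i}"
proof (rule finite_subset)
  show "{a :: nat list. length a = l \<and> sum_list a = i} \<subseteq> {a. set a \<subseteq> {..i} \<and> length a = l}"
    using member_le_sum_list by fastforce
  show "finite {a :: nat list. set a \<subseteq> {..i} \<and> length a = l}"
    by (rule finite_lists_length_eq) simp
qed

lemma length_split1:
  assumes "length a = l + (m + Suc 0)"
  obtains b k c where "a = b @ k # c" "length b = l" "length c = m"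
proof
  show "a = take l a @ a ! l # drop (Suc l) a"
    using assms by (intro id_take_nth_drop) simp
qed (use assms in simp_all)

lemma length_split2:
  assumes "length a = l + (m + Suc 0 + Suc 0)"
  obtains b k k' c where "a = b @ k # k' # c" "length b = l" "length c = m"
proof -
  obtain b k c where 1: "a = b @ k # c" "length b = l" "length c = Suc m"
    by (rule length_split1[of a l "Suc m"]) (use assms in auto)
  then obtain k' c' where "c = k' # c'" by (cases c) auto
  with 1 that show thesis by auto
qed

lemma sigma_null:
  assumes "ext_null x" shows "ext_null (word_ext (sigma_word i) x)"
proof (rule word_ext_null[OF assms])
  let ?m = "\<lambda>k v. monom 1 k * v :: 'a poly"
  fix us v w a and ws :: "'a poly list"
  show "ext_null (sigma_word i (us @ (v + w) # ws) - sigma_word i (us @ v # ws)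
          - sigma_word i (us @ w # ws))"
    unfolding sigma_word_def length_append list.size sum_subtractf[symmetric]
  proof (rule ext_null_sum, clarify)
    fix n :: "nat list" assume "length n = length us + (length ws + Suc 0)"
    then obtain b k c where n: "n = b @ k # c" "length b = length us" "length c = length ws"
      by (rule length_split1)
    show "ext_null (word (map2 ?m n (us @ (v + w) # ws)) - word (map2 ?m n (us @ v # ws))
            - word (map2 ?m n (us @ w # ws)))"
      using n ext_null.lin_add[of "map2 ?m b us" "?m k v" "?m k w" "map2 ?m c ws"]
      by (simp add: distrib_left)
  qed
  show "ext_null (sigma_word i (us @ smult a v # ws) - wscale a (sigma_word i (us @ v # ws)))"
    unfolding sigma_word_def length_append list.size sum_subtractf[symmetric] wscale_sum
  proof (rule ext_null_sum, clarify)
    fix n :: "nat list" assume "length n = length us + (length ws + Suc 0)"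
    then obtain b k c where n: "n = b @ k # c" "length b = length us" "length c = length ws"
      by (rule length_split1)
    show "ext_null (word (map2 ?m n (us @ smult a v # ws))
            - wscale a (word (map2 ?m n (us @ v # ws))))"
      using n ext_null.lin_smult[of "map2 ?m b us" a "?m k v" "map2 ?m c ws"] by simp
  qed
  show "ext_null (sigma_word i (us @ v # v # ws))"
  proof -
    define A where "A = {n :: nat list. length n = length (us @ v # v # ws) \<and> sum_list n = i}"
    define p where "p = length us"
    define T where "T n = word (map2 ?m n (us @ v # v # ws))" for n
    define s where "s n = n[p := n ! Suc p, Suc p := n ! p]" for n :: "nat list"
    have dec: "\<exists>b k l c. n = b @ k # l # c \<and> length b = p \<and> length c = length ws" if "n \<in> A" for n
    proof -
      have "length n = p + (length ws + Suc 0 + Suc 0)" using that by (simp add: A_def p_def)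
      then show ?thesis by (rule length_split2) blast
    qed
    have s_eq: "s (b @ k # l # c) = b @ l # k # c" if "length b = p" for b k l c
      using that by (simp add: s_def list_update_append nth_append)
    have sA: "s n \<in> A" and ss: "s (s n) = n" and pos: "s n ! p = n ! Suc p" "s n ! Suc p = n ! p"
      and Tpair: "ext_null (T n + T (s n))" if nA: "n \<in> A" for n
    proof -
      from dec[OF nA] obtain b k l c where n: "n = b @ k # l # c" "length b = p" "length c = length ws"
        by blast
      have sn: "s n = b @ l # k # c" unfolding n(1) by (rule s_eq[OF n(2)])
      show "s n \<in> A" using nA unfolding sn unfolding n(1) by (simp add: A_def)
      show "s (s n) = n" unfolding sn unfolding n(1) by (rule s_eq[OF n(2)])
      show "s n ! p = n ! Suc p" "s n ! Suc p = n ! p"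
        unfolding sn unfolding n(1) by (simp_all add: n(2)[symmetric] nth_append)
      show "ext_null (T n + T (s n))"
        unfolding T_def sn unfolding n(1)
        using word_swap_null[of "map2 ?m b us" "?m k v" "?m l v" "map2 ?m c ws"] n(2,3)
        by (simp add: p_def)
    qed
    have Tdiag: "ext_null (T n)" if nA: "n \<in> A" and eq: "n ! p = n ! Suc p" for n
    proof -
      from dec[OF nA] obtain b k l c where n: "n = b @ k # l # c" "length b = p" "length c = length ws"
        by blast
      have "k = l" using eq unfolding n(1) by (simp add: n(2)[symmetric] nth_append)
      then show ?thesis
        unfolding T_def n(1)
        using ext_null.alt[of "map2 ?m b us" "?m k v" "map2 ?m c ws"] n(2,3)
        by (simp add: p_def)
    qed
    define L where "L = {n \<in> A. n ! p < n ! Suc p}"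
    define E where "E = {n \<in> A. n ! p = n ! Suc p}"
    define G where "G = {n \<in> A. n ! p > n ! Suc p}"
    have fin: "finite A" unfolding A_def by (rule finite_compositions)
    have "sum T G = (\<Sum>n\<in>L. T (s n))"
      by (rule sum.reindex_bij_witness[of _ s s]) (auto simp: L_def G_def sA ss pos)
    moreover have "sum T A = sum T L + sum T E + sum T G"
    proof -
      have "A = (L \<union> E) \<union> G" by (auto simp: L_def E_def G_def)
      moreover have "finite L" "finite E" "finite G" "L \<inter> E = {}" "(L \<union> E) \<inter> G = {}"
        using fin by (auto simp: L_def E_def G_def)
      ultimately show ?thesis by (simp add: sum.union_disjoint)
    qed
    ultimately have "sum T A = (\<Sum>n\<in>L. T n + T (s n)) + sum T E"
      by (simp add: sum.distrib algebra_simps)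
    moreover have "ext_null \<dots>"
      by (rule ext_null.add; rule ext_null_sum) (simp_all add: L_def E_def Tpair Tdiag)
    moreover have "sigma_word i (us @ v # v # ws) = sum T A"
      by (simp add: sigma_word_def A_def T_def)
    ultimately show ?thesis by simp
  qed
qed

lemma remove_left:
  assumes "k < length us"
  shows "take k (us @ vs) @ drop (Suc k) (us @ vs) = (take k us @ drop (Suc k) us) @ vs"
    and "(us @ vs) ! k = us ! k"
  using assms by (simp_all add: nth_append)

lemma remove_right:
  "take (length us + k) (us @ vs) @ drop (Suc (length us + k)) (us @ vs)
     = us @ take k vs @ drop (Suc k) vs"
  "(us @ vs) ! (length us + k) = vs ! k"
  by (simp_all add: nth_append)

lemma sum_lessThan_add:
  "(\<Sum>k<m + l. f k) = (\<Sum>k<m. f k) + (\<Sum>k<l. f (m + k) :: 'b::comm_monoid_add)"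
  for m l :: nat
  by (induction l) (simp_all add: add.assoc)

lemma contract_word_append:
  "contract_word d (us @ vs) =
     (\<Sum>k<length us. wscale ((-1) ^ k * d (us ! k))
        (word ((take k us @ drop (Suc k) us) @ vs))) +
     (\<Sum>k<length vs. wscale ((-1) ^ (length us + k) * d (vs ! k))
        (word (us @ take k vs @ drop (Suc k) vs)))"
proof -
  let ?h = "\<lambda>k. wscale ((-1) ^ k * d ((us @ vs) ! k))
              (word (take k (us @ vs) @ drop (Suc k) (us @ vs)))"
  have "contract_word d (us @ vs) = sum ?h {..<length us + length vs}"
    by (simp only: contract_word_def length_append)
  also have "\<dots> = sum ?h {..<length us} + (\<Sum>k<length vs. ?h (length us + k))"
    by (rule sum_lessThan_add)
  also have "sum ?h {..<length us} = (\<Sum>k<length us. wscale ((-1) ^ k * d (us ! k))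
        (word ((take k us @ drop (Suc k) us) @ vs)))"
    by (rule sum.cong) (simp_all only: remove_left lessThan_iff)
  also have "(\<Sum>k<length vs. ?h (length us + k)) =
       (\<Sum>k<length vs. wscale ((-1) ^ (length us + k) * d (vs ! k))
        (word (us @ take k vs @ drop (Suc k) vs)))"
    by (rule sum.cong) (simp_all only: remove_right)
  finally show ?thesis .
qed

lemma contract_word_Cons:
  "contract_word d (us @ v # ws) =
     (\<Sum>k<length us. wscale ((-1) ^ k * d (us ! k))
        (word ((take k us @ drop (Suc k) us) @ v # ws))) +
     wscale ((-1) ^ length us * d v) (word (us @ ws)) +
     (\<Sum>k<length ws. wscale ((-1) ^ Suc (length us + k) * d (ws ! k))
        (word (us @ v # take k ws @ drop (Suc k) ws)))"
  unfolding contract_word_append by (simp add: sum.lessThan_Suc_shift add.assoc del: sum.lessThan_Suc)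

lemma contract_null:
  fixes d :: "'a::comm_ring_1 poly \<Rightarrow> 'a"
  assumes "ext_null x" and d: "\<And>v w. d (v + w) = d v + d w" "\<And>a v. d (Polynomial.smult a v) = a * d v"
  shows "ext_null (word_ext (contract_word d) x)"
proof (rule word_ext_null[OF assms(1)])
  fix us v w and a :: 'a and ws :: "'a poly list"
  define P where "P u = (\<Sum>k<length us. wscale ((-1) ^ k * d (us ! k))
        (word ((take k us @ drop (Suc k) us) @ u # ws)))" for u
  define Q where "Q u = (\<Sum>k<length ws. wscale ((-1) ^ Suc (length us + k) * d (ws ! k))
        (word (us @ u # take k ws @ drop (Suc k) ws)))" for u
  define M where "M u = wscale ((-1) ^ length us * d u) (word (us @ ws))" for u
  have c: "contract_word d (us @ u # ws) = P u + M u + Q u" for u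
    by (simp only: contract_word_Cons P_def M_def Q_def)
  have "ext_null (P (v + w) - P v - P w)" "ext_null (Q (v + w) - Q v - Q w)"
    unfolding P_def Q_def sum_subtractf[symmetric] wscale_diff[symmetric]
    using ext_null.lin_add by (blast intro: ext_null_sum ext_null.scale)+
  moreover have "M (v + w) = M v + M w"
    by (simp add: M_def d distrib_left wscale_add_left)
  ultimately show "ext_null (contract_word d (us @ (v + w) # ws) - contract_word d (us @ v # ws)
      - contract_word d (us @ w # ws))"
    using ext_null.add[of "P (v + w) - P v - P w" "Q (v + w) - Q v - Q w"]
    by (simp add: c algebra_simps)
  have comm: "wscale b (wscale a x) = wscale a (wscale b x)" for b x
    by (rule poly_mapping_eqI) (simp add: mult_ac)
  have "ext_null (P (Polynomial.smult a v) - wscale a (P v))"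
    "ext_null (Q (Polynomial.smult a v) - wscale a (Q v))"
    unfolding P_def Q_def wscale_sum comm[symmetric] sum_subtractf[symmetric] wscale_diff[symmetric]
    using ext_null.lin_smult by (blast intro: ext_null_sum ext_null.scale)+
  moreover have "M (Polynomial.smult a v) = wscale a (M v)"
    by (rule poly_mapping_eqI) (simp add: M_def d mult_ac)
  ultimately show "ext_null (contract_word d (us @ Polynomial.smult a v # ws)
      - wscale a (contract_word d (us @ v # ws)))"
    using ext_null.add[of "P (Polynomial.smult a v) - wscale a (P v)"
        "Q (Polynomial.smult a v) - wscale a (Q v)"]
    by (simp add: c wscale_add algebra_simps)
next
  fix us v and ws :: "'a poly list"
  have swap: "wscale ((-1) ^ length us * d v) (word (us @ v # ws))
      + wscale ((-1) ^ Suc (length us) * d v) (word (us @ v # ws)) = 0"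
    by (simp flip: wscale_add_left)
  have "contract_word d (us @ v # v # ws) =
     (\<Sum>k<length us. wscale ((-1) ^ k * d (us ! k))
        (word ((take k us @ drop (Suc k) us) @ v # v # ws))) +
     (\<Sum>k<length ws. wscale ((-1) ^ Suc (length us + Suc k) * d (ws ! k))
        (word (us @ v # v # take k ws @ drop (Suc k) ws)))"
    using swap unfolding contract_word_Cons
    by (simp add: sum.lessThan_Suc_shift wscale_uminus del: sum.lessThan_Suc)
  also have "ext_null \<dots>"
    using ext_null.alt by (blast intro: ext_null.add ext_null_sum ext_null.scale)
  finally show "ext_null (contract_word d (us @ v # v # ws))" .
qed

lift_definition wedge_left :: "'a::comm_ring_1 poly \<Rightarrow> 'a ext \<Rightarrow> 'a ext"
  is "\<lambda>u. word_ext (wedge_left_word u)"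
  by (simp add: word_ext_diff[symmetric] wedge_left_null)

lift_definition sigma :: "nat \<Rightarrow> 'a::comm_ring_1 ext \<Rightarrow> 'a ext"
  is "\<lambda>i. word_ext (sigma_word i)"
  by (simp add: word_ext_diff[symmetric] sigma_null)

text \<open>The contraction \<open>\<partial>\<^sup>j \<lrcorner> x\<close>, where \<open>\<partial>\<^sup>j\<close> is the \<open>j\<close>-th coefficient form.\<close>

lift_definition contract :: "nat \<Rightarrow> 'a::comm_ring_1 ext \<Rightarrow> 'a ext"
  is "\<lambda>j. word_ext (contract_word (\<lambda>p. coeff p j))"
  by (simp add: word_ext_diff[symmetric] contract_null)

subsection \<open>The rings\<close>

text \<open>
  The numbers of variables are carried by the types: \<open>n = CARD('n)\<close> and \<open>r = CARD('r)\<close>, so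
  \<open>n, r \<ge> 1\<close> automatically. The class \<^class>\<open>enum\<close> fixes the order of the variables.
\<close>

type_synonym 'n base = "('n \<Rightarrow>\<^sub>0 nat) \<Rightarrow>\<^sub>0 rat"
type_synonym ('r, 'n) rpoly = "('r \<Rightarrow>\<^sub>0 nat) \<Rightarrow>\<^sub>0 'n base"

text \<open>The \<open>i\<close>-th variable, with the conventions \<open>c\<^sub>0 = 1\<close> and \<open>c\<^sub>i = 0\<close> beyond the last variable.\<close>

definition variable :: "nat \<Rightarrow> ('x::enum \<Rightarrow>\<^sub>0 nat) \<Rightarrow>\<^sub>0 'a::comm_ring_1" where
  "variable i =
     (if i = 0 then 1
      else if i \<le> CARD('x) then
        Poly_Mapping.single (Poly_Mapping.single ((enum_class.enum :: 'x list) ! (i - 1)) 1) 1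
      else 0)"

definition cvar :: "nat \<Rightarrow> 'n::enum base" where
  "cvar = variable"

definition evar :: "nat \<Rightarrow> ('r::enum, 'n::enum) rpoly" where
  "evar = variable"

definition base_const :: "'n::enum base \<Rightarrow> ('r::enum, 'n) rpoly" where
  "base_const a = Poly_Mapping.single 0 a"

definition Xc :: "nat \<Rightarrow> 'n::enum base poly" where
  "Xc j = (\<Sum>i\<le>j. monom ((-1) ^ i * cvar i) (j - i))"

definition E_series :: "('r::enum, 'n::enum) rpoly fps" where
  "E_series = Abs_fps (\<lambda>j. (-1) ^ j * evar j)"

text \<open>\<open>1 / E\<^sub>r(z)\<close>; the second argument of \<^term>\<open>fps_right_inverse\<close> inverts the constant term.\<close>

definition E_inv :: "('r::enum, 'n::enum) rpoly fps" where
  "E_inv = fps_right_inverse E_series 1"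

definition c_series :: "('r::enum, 'n::enum) rpoly fps" where
  "c_series = Abs_fps (\<lambda>i. (-1) ^ i * base_const (cvar i))"

definition h_var :: "nat \<Rightarrow> ('r::enum, 'n::enum) rpoly" where
  "h_var j = fps_nth E_inv j"

definition hc :: "int \<Rightarrow> ('r::enum, 'n::enum) rpoly" where
  "hc j = (if j < 0 then 0 else fps_nth (c_series * E_inv) (nat j))"

text \<open>Determinants with rows and columns numbered from 1.\<close>

definition det1 :: "nat \<Rightarrow> (nat \<Rightarrow> nat \<Rightarrow> 'a::comm_ring_1) \<Rightarrow> 'a" where
  "det1 r A = Determinant.det (Matrix.mat r r (\<lambda>(k, j). A (k + 1) (j + 1)))"

text \<open>
  A partition of length at most \<open>r\<close> is a function \<open>\<lambda>\<close> that is weakly decreasing on \<open>{1..r}\<close>; its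
  values elsewhere are never used.
\<close>

definition Delta :: "(nat \<Rightarrow> nat) \<Rightarrow> ('r::enum, 'n::enum) rpoly" where
  "Delta lam = det1 CARD('r) (\<lambda>k j. hc (int (lam j) - int j + int k))"

definition Xwedge :: "nat \<Rightarrow> (nat \<Rightarrow> nat) \<Rightarrow> 'n::enum base ext" where
  "Xwedge r lam = wedge (map (\<lambda>j. Xc (r - j + lam j)) [1..<r + 1])"

subsection \<open>The module structure and the operator\<close>

definition is_action ::
  "(('r::enum, 'n::enum) rpoly \<Rightarrow> 'n base ext \<Rightarrow> 'n base ext) \<Rightarrow> bool" where
  "is_action act \<longleftrightarrow>
     (let W = ext_power CARD('r) in
       (\<forall>f. \<forall>u\<in>W. act f u \<in> W) \<and>
       (\<forall>f. \<forall>u\<in>W. \<forall>v\<in>W. act f (u + v) = act f u + act f v) \<and>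
       (\<forall>f g. \<forall>u\<in>W. act (f + g) u = act f u + act g u) \<and>
       (\<forall>f g. \<forall>u\<in>W. act (f * g) u = act f (act g u)) \<and>
       (\<forall>a. \<forall>u\<in>W. act (base_const a) u = ext_scale a u) \<and>
       (\<forall>i. \<forall>u\<in>W. act (h_var i) u = sigma i u))"

text \<open>
  The conditions determine the action on the \<open>r\<close>-th exterior power, because the \<open>h_var i\<close> generate the
  ring over the base ring; elsewhere the values are irrelevant.
\<close>

definition action :: "('r::enum, 'n::enum) rpoly \<Rightarrow> 'n base ext \<Rightarrow> 'n base ext" where
  "action = (SOME act. is_action act)"

text \<open>
  In \<open>'a fps fps\<close> the coefficient of \<open>z\<^sup>i w\<^sup>-\<^sup>j\<close> of \<open>F\<close> is \<open>fps_nth (fps_nth F i) j\<close>. The defining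
  equation of the operator is compared coefficientwise.
\<close>

definition is_vertex_op ::
  "(('r::enum, 'n::enum) rpoly \<Rightarrow> ('r, 'n) rpoly fps fps) \<Rightarrow> bool" where
  "is_vertex_op E \<longleftrightarrow>
     (\<forall>f g. E (f + g) = E f + E g) \<and>
     (\<forall>a f. E (base_const a * f) = fps_const (fps_const (base_const a)) * E f) \<and>
     (\<forall>lam. antimono_on {1..CARD('r)} lam \<longrightarrow>
        (\<forall>i j. action (fps_nth (fps_nth (E (Delta lam)) i) j) (Xwedge CARD('r) (\<lambda>_. 0)) =
           wedge_left (monom 1 i) (contract j (Xwedge CARD('r) lam))))"

definition vertex_op :: "('r::enum, 'n::enum) rpoly \<Rightarrow> ('r, 'n) rpoly fps fps" where
  "vertex_op = (THE E. is_vertex_op E)"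

subsection \<open>The determinant with the row of powers of \<open>w\<^sup>-\<^sup>1\<close>\<close>

text \<open>
  The identity lives in \<open>B((w\<^sup>-\<^sup>1))((z))\<close>: the outer Laurent variable is \<open>z\<close>, the inner one is
  \<open>w\<^sup>-\<^sup>1\<close>.
\<close>

type_synonym 'a laurent = "'a fls fls"

definition z_var :: "'a::comm_ring_1 laurent" where "z_var = fls_X"
definition z_inv :: "'a::comm_ring_1 laurent" where "z_inv = fls_X_inv"
definition w_inv :: "'a::comm_ring_1 laurent" where "w_inv = fls_const fls_X"
definition w_var :: "'a::comm_ring_1 laurent" where "w_var = fls_const fls_X_inv"

definition lconst :: "'a::comm_ring_1 \<Rightarrow> 'a laurent" where
  "lconst a = fls_const (fls_const a)"

definition laurent_of_zw :: "'a::comm_ring_1 fps fps \<Rightarrow> 'a laurent" where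
  "laurent_of_zw F = fps_to_fls (Abs_fps (\<lambda>i. fps_to_fls (fps_nth F i)))"

definition laurent_of_z :: "'a::comm_ring_1 fps \<Rightarrow> 'a laurent" where
  "laurent_of_z F = fps_to_fls (Abs_fps (\<lambda>i. fls_const (fps_nth F i)))"

definition w_inv_c :: "nat \<Rightarrow> ('r::enum, 'n::enum) rpoly laurent" where
  "w_inv_c m = poly (map_poly (\<lambda>a. lconst (base_const a)) (Xc m)) w_inv"

definition sigma_minus_hc :: "int \<Rightarrow> ('r::enum, 'n::enum) rpoly laurent" where
  "sigma_minus_hc j = lconst (hc j) - lconst (hc (j - 1)) * z_inv"

definition Delta_w :: "(nat \<Rightarrow> nat) \<Rightarrow> ('r::enum, 'n::enum) rpoly laurent" where
  "Delta_w lam =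
     w_var ^ (CARD('r) - 1) *
     det1 CARD('r) (\<lambda>k j.
       if k = 1 then w_inv_c (CARD('r) - j + lam j)
       else sigma_minus_hc (int (lam j) - int j + int k))"

end

theory Submission
  imports Defs
begin

text \<open>
  Both sides are computed by one map. Let \<open>L\<^sub>k\<close> (\<open>1 \<le> k \<le> r\<close>) be the \<open>B\<^sub>0(c)\<close>-linear form on \<open>V(c)\<close> with values in
  \<open>B\<^sub>r(c)\<close> that sends \<open>X\<^sup>a\<close> to \<open>h\<^bsub>a-r+k\<^esub>\<close>, and let \<open>\<phi>(v\<^sub>1 \<and> \<dots> \<and> v\<^sub>r) = det (L\<^sub>k(v\<^sub>j))\<close>. Since \<open>L\<^sub>k(X\<^sup>a(c)) = h\<^bsub>a-r+k\<^esub>(c)\<close>,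
  the map \<open>\<phi>\<close> sends \<open>[X(c)]\<^sub>\<lambda>\<close> to \<open>\<Delta>\<^sub>\<lambda>(H\<^sub>r(c))\<close> and \<open>[X(c)]\<^sub>0\<close> to 1 (\<open>phi_Xwedge\<close>, \<open>phi_Xwedge_zero\<close>).
  Moreover \<open>\<phi>\<close> is an isomorphism of \<open>B\<^sub>r(c)\<close>-modules from the exterior power onto \<open>B\<^sub>r(c)\<close>, for three reasons.

  \<^item> It turns \<open>\<sigma>\<^sub>i\<close> into multiplication by \<open>h\<^sub>i\<close> (\<open>phi_sigma\<close>): the generating function of the \<open>\<phi>(\<sigma>\<^sub>i u)\<close> is a determinant
    of power series that a triangular system of determinant \<open>E\<^sub>r(z)\<close> relates to \<open>\<phi>(u)\<close>.
  \<^item> It is onto (\<open>phi_surj\<close>), because the \<open>h\<^sub>i\<close> generate \<open>B\<^sub>r(c)\<close> and 1 is in the image.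
  \<^item> It is injective (\<open>phi_inj\<close>): if the \<open>e\<^sub>i\<close> are specialised to the elementary symmetric polynomials of
    roots \<open>x\<^sub>i\<close>, the alternant \<open>det (v\<^sub>j(x\<^sub>i))\<close> becomes a multiple of \<open>\<phi>\<close>, and alternants with strictly decreasing
    exponents are linearly independent.

  Hence an action and a vertex operator with the defining properties exist, the latter is unique, and the
  coefficient of \<open>z\<^sup>i w\<^sup>-\<^sup>j\<close> in its value at \<open>\<Delta>\<^sub>\<lambda>(H\<^sub>r(c))\<close> is \<open>\<phi>(X\<^sup>i \<and> (\<partial>\<^sup>j \<lrcorner> [X(c)]\<^sub>\<lambda>))\<close> (\<open>vertex_op_Delta\<close>).

  The formula is then a computation with determinants. The column of \<open>X\<^sup>i\<close> has entries \<open>h\<^bsub>i-r+k\<^esub>\<close>, whose generating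
  functions are \<open>z\<^bsup>r-k\<^esup>/E\<^sub>r(z)\<close>; the contraction contributes alternating factors \<open>w\<^bsup>-a\<^esup>(c)\<close> with \<open>a = r - j + \<lambda>\<^sub>j\<close>.
  Row operations with \<open>z\<^sup>-\<^sup>1\<close> clear the column of powers of \<open>z\<close> and replace every \<open>h\<^sub>j(c)\<close> by
  \<open>h\<^sub>j(c) - z\<^sup>-\<^sup>1 h\<^bsub>j-1\<^esub>(c)\<close> (\<open>det_bordered_powers\<close>). What remains is the Laplace expansion of the stated determinant along
  its first row.
\<close>

section \<open>Determinants of linear forms on the exterior algebra\<close>

text \<open>
  A family of linear forms \<open>L\<^sub>k\<close> on \<open>R[X]\<close> with values in an \<open>R\<close>-algebra, given by the values
  \<open>g k n\<close> of \<open>L\<^sub>k\<close> on \<open>X\<^sup>n\<close>. The determinant \<open>det (L\<^sub>k(v\<^sub>j))\<close> is multilinear and alternating in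
  the \<open>v\<^sub>j\<close>, so it descends to the exterior algebra. Two families matter below: one with values in
  \<open>B\<^sub>r(c)\<close>, which identifies the exterior power with \<open>B\<^sub>r(c)\<close>, and evaluation at \<open>r\<close> roots, which
  shows that the first one loses nothing.
\<close>

locale form_family = comm_ring_hom hom
  for hom :: "'a::comm_ring_1 \<Rightarrow> 'b::comm_ring_1" +
  fixes r :: nat and g :: "nat \<Rightarrow> nat \<Rightarrow> 'b"
begin

definition form :: "nat \<Rightarrow> 'a poly \<Rightarrow> 'b" where
  "form k v = (\<Sum>n\<le>degree v. hom (coeff v n) * g k n)"

lemma form_superset: "degree v \<le> N \<Longrightarrow> form k v = (\<Sum>n\<le>N. hom (coeff v n) * g k n)"
  unfolding form_def by (rule sum.mono_neutral_left) (auto simp: coeff_eq_0)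

lemma form_add: "form k (v + w) = form k v + form k w"
proof -
  let ?N = "max (degree v) (degree w)"
  show ?thesis
    using form_superset[of "v + w" ?N] form_superset[of v ?N] form_superset[of w ?N]
      degree_add_le[of v ?N w]
    by (simp add: hom_add distrib_right sum.distrib)
qed

lemma form_smult: "form k (Polynomial.smult a v) = hom a * form k v"
  using form_superset[of "Polynomial.smult a v" "degree v"] form_superset[of v "degree v"] degree_smult_le[of a v]
  by (simp add: hom_mult sum_distrib_left mult.assoc)

lemma form_monom: "form k (monom a n) = hom a * g k n"
proof -
  have "form k (monom a n) = (\<Sum>i\<le>n. hom (coeff (monom a n) i) * g k i)"
    by (rule form_superset) (rule degree_monom_le)
  also have "\<dots> = (\<Sum>i\<in>{n}. hom (coeff (monom a n) i) * g k i)"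
    by (rule sum.mono_neutral_right) auto
  finally show ?thesis by simp
qed

lemma form_zero: "form k 0 = 0"
  by (simp add: form_def)

lemma form_sum: "form k (\<Sum>i\<in>A. f i) = (\<Sum>i\<in>A. form k (f i))"
  by (induction A rule: infinite_finite_induct) (auto simp: form_add form_zero)

definition form_mat :: "'a poly list \<Rightarrow> 'b mat" where
  "form_mat vs = mat r r (\<lambda>(k, j). form k (vs ! j))"

definition word_det :: "'a poly list \<Rightarrow> 'b" where
  "word_det vs = (if length vs = r then Determinant.det (form_mat vs) else 0)"

lemma form_mat_carrier [simp]: "form_mat vs \<in> carrier_mat r r"
  "dim_row (form_mat vs) = r" "dim_col (form_mat vs) = r"
  by (simp_all add: form_mat_def)

text \<open>
  Laplace expansion along the column of \<open>v\<close>: the cofactors do not see that column, so they may be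
  computed with \<open>0\<close> in its place. All linearity statements follow from this.
\<close>

lemma word_det_column:
  assumes "length us + length ws + 1 = r"
  shows "word_det (us @ v # ws) =
     (\<Sum>i<r. form i v * cofactor (form_mat (us @ 0 # ws)) i (length us))"
proof -
  have "mat_delete (form_mat (us @ v # ws)) i (length us)
        = mat_delete (form_mat (us @ 0 # ws)) i (length us)" for i
    by (rule eq_matI) (auto simp: mat_delete_def form_mat_def nth_append nth_Cons')
  then have "cofactor (form_mat (us @ v # ws)) i (length us) =
      cofactor (form_mat (us @ 0 # ws)) i (length us)" for i
    by (simp add: cofactor_def)
  then show ?thesis
    using assms laplace_expansion_column[OF form_mat_carrier(1), of "length us" "us @ v # ws"]
    by (simp add: word_det_def form_mat_def)
qed

lemma word_det_add:
  "word_det (us @ (v + w) # ws) = word_det (us @ v # ws) + word_det (us @ w # ws)"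
proof (cases "length us + length ws + 1 = r")
  case True
  then show ?thesis by (simp add: word_det_column form_add distrib_right sum.distrib)
qed (simp add: word_det_def)

lemma word_det_smult:
  "word_det (us @ Polynomial.smult a v # ws) = hom a * word_det (us @ v # ws)"
proof (cases "length us + length ws + 1 = r")
  case True
  then show ?thesis by (simp add: word_det_column form_smult sum_distrib_left mult.assoc)
qed (simp add: word_det_def)

lemma word_det_alt: "word_det (us @ v # v # ws) = 0"
proof (cases "length us + length ws + 2 = r")
  case True
  then have "Determinant.det (form_mat (us @ v # v # ws)) = 0"
    by (intro det_identical_columns[OF form_mat_carrier(1), of "length us" "Suc (length us)"])
      (auto simp: form_mat_def nth_append)
  then show ?thesis by (simp add: word_det_def)
qed (simp add: word_det_def)

definition words_det :: "'a words \<Rightarrow> 'b" where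
  "words_det x = (\<Sum>vs\<in>Poly_Mapping.keys x. hom (Poly_Mapping.lookup x vs) * word_det vs)"

lemma words_det_superset:
  "finite A \<Longrightarrow> Poly_Mapping.keys x \<subseteq> A \<Longrightarrow>
     words_det x = (\<Sum>vs\<in>A. hom (Poly_Mapping.lookup x vs) * word_det vs)"
  unfolding words_det_def by (rule sum.mono_neutral_left) (auto simp: in_keys_iff)

lemma words_det_add: "words_det (x + y) = words_det x + words_det y"
proof -
  let ?A = "Poly_Mapping.keys x \<union> Poly_Mapping.keys y"
  have "Poly_Mapping.keys (x + y) \<subseteq> ?A" by (rule Poly_Mapping.keys_add)
  then show ?thesis
    by (simp add: words_det_superset[of ?A] lookup_add hom_add distrib_right sum.distrib)
qed

lemma words_det_scale: "words_det (wscale a x) = hom a * words_det x"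
proof -
  have "Poly_Mapping.keys (wscale a x) \<subseteq> Poly_Mapping.keys x"
    by (auto simp: in_keys_iff)
  then show ?thesis
    by (simp add: words_det_superset[of "Poly_Mapping.keys x"] hom_mult sum_distrib_left mult.assoc)
qed

lemma words_det_uminus: "words_det (- x) = - words_det x"
  using words_det_scale[of "-1" x] by (simp add: wscale_uminus hom_uminus)

lemma words_det_diff: "words_det (x - y) = words_det x - words_det y"
  using words_det_add[of x "- y"] by (simp add: words_det_uminus)

lemma words_det_word [simp]: "words_det (word vs) = word_det vs"
  by (simp add: words_det_def)

lemma words_det_null: "ext_null x \<Longrightarrow> words_det x = 0"
proof (induction rule: ext_null.induct)
  case zero
  show ?case by (simp add: words_det_def)
qed (simp_all add: words_det_add words_det_scale words_det_diff word_det_add word_det_smult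
      word_det_alt)

definition ext_det :: "'a ext \<Rightarrow> 'b" where
  "ext_det u = words_det (rep_ext u)"

lemma ext_det_abs [simp]: "ext_det (abs_ext x) = words_det x"
proof -
  have "ext_null (rep_ext (abs_ext x) - x)"
    using Quotient3_rep_abs[OF Quotient3_ext, of x] by (simp add: ext_null.zero)
  then show ?thesis using words_det_null by (fastforce simp: ext_det_def words_det_diff)
qed

lemma ext_det_wedge: "ext_det (wedge vs) = word_det vs"
  by (simp add: wedge_def)

lemma ext_det_add: "ext_det (u + v) = ext_det u + ext_det v"
  by (induction u, induction v) (simp add: plus_ext.abs_eq words_det_add)

lemma ext_det_scale: "ext_det (ext_scale a u) = hom a * ext_det u"
  by (induction u) (simp add: ext_scale.abs_eq words_det_scale)

lemma ext_det_zero: "ext_det 0 = 0"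
  using ext_det_add[of 0 0] by simp

lemma ext_det_diff: "ext_det (u - v) = ext_det u - ext_det v"
  using ext_det_add[of "u - v" v] by simp

lemma ext_det_sum: "ext_det (\<Sum>i\<in>A. f i) = (\<Sum>i\<in>A. ext_det (f i))"
  by (induction A rule: infinite_finite_induct) (auto simp: ext_det_add ext_det_zero)

end

text \<open>
  If two families of forms satisfy a matrix relation \<open>T L' = T' L\<close> on the monomials, then they
  satisfy it on all polynomials, and the determinants are related by \<open>det T\<close> and \<open>det T'\<close>. This is
  the only way in which determinants of different families are compared below.
\<close>

lemma word_det_change:
  fixes rho :: "'b::comm_ring_1 \<Rightarrow> 'c::comm_ring_1"
  assumes "comm_ring_hom h" "comm_ring_hom h'" "comm_ring_hom rho" 
    and h': "\<And>a. h' a = rho (h a)"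
    and rel: "\<And>k n. k < r \<Longrightarrow> (\<Sum>m<r. T k m * g' m n) = (\<Sum>m<r. T' k m * rho (g m n))"
    and len: "length vs = r"
  shows "Determinant.det (mat r r (\<lambda>(k, m). T k m)) * form_family.word_det h' r g' vs
       = Determinant.det (mat r r (\<lambda>(k, m). T' k m)) * rho (form_family.word_det h r g vs)"
proof -
  interpret A: form_family h r g using assms(1) by (simp add: form_family_def)
  interpret B: form_family h' r g' using assms(2) by (simp add: form_family_def)
  interpret rho: comm_ring_hom rho by fact
  have form: "(\<Sum>m<r. T k m * B.form m v) = (\<Sum>m<r. T' k m * rho (A.form m v))" if "k < r" for k v
  proof -
    have "(\<Sum>m<r. T k m * B.form m v) = (\<Sum>n\<le>degree v. h' (coeff v n) * (\<Sum>m<r. T k m * g' m n))"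
      unfolding B.form_def sum_distrib_left by (subst sum.swap) (simp add: mult_ac)
    also have "\<dots> = (\<Sum>n\<le>degree v. h' (coeff v n) * (\<Sum>m<r. T' k m * rho (g m n)))"
      using rel[OF that] by simp
    also have "\<dots> = (\<Sum>m<r. T' k m * rho (A.form m v))"
      unfolding A.form_def rho.hom_sum rho.hom_mult h' sum_distrib_left
      by (subst sum.swap) (simp add: mult_ac)
    finally show ?thesis .
  qed
  have "mat r r (\<lambda>(k, m). T k m) * B.form_mat vs = mat r r (\<lambda>(k, m). T' k m) * map_mat rho (A.form_mat vs)"
    by (rule eq_matI)
      (auto simp: A.form_mat_def B.form_mat_def scalar_prod_def form
        simp flip: lessThan_atLeast0)
  then have "Determinant.det (mat r r (\<lambda>(k, m). T k m) * B.form_mat vs) =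
     Determinant.det (mat r r (\<lambda>(k, m). T' k m) * map_mat rho (A.form_mat vs))"
    by simp
  then show ?thesis
    using len by (simp add: det_mult[where n=r] A.word_det_def B.word_det_def rho.hom_det)
qed

text \<open>
  The sum over all ways of distributing \<open>i\<close> factors \<open>X\<close> over the letters of a word is a
  coefficient of a single determinant over power series: replace each \<open>L\<^sub>k(v)\<close> by
  \<open>\<Sum>\<^sub>a L\<^sub>k(X\<^sup>a v) z\<^sup>a\<close> and expand.
\<close>

lemma (in form_family) shift_word_det_nth:
  assumes g': "\<And>k n a. fps_nth (g' k n) a = g k (n + a)" and len: "length vs = r"
  shows "fps_nth (form_family.word_det (\<lambda>a. fps_const (hom a)) r g' vs) i =
    (\<Sum>a\<in>natpermute i r. word_det (map2 (\<lambda>k v. monom 1 k * v) a vs))"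
proof -
  interpret const: comm_ring_hom "fps_const :: 'b \<Rightarrow> 'b fps"
    by unfold_locales (simp_all flip: fps_const_add fps_const_mult)
  interpret B: form_family "\<lambda>a. fps_const (hom a)" r g'
    by unfold_locales (auto simp: hom_add hom_mult)
  have form: "fps_nth (B.form k v) a = form k (monom 1 a * v)" for k v a
  proof -
    have "degree (monom 1 a * v) \<le> degree v + a"
      using degree_mult_le[of "monom 1 a" v] degree_monom_le[of "1::'a" a] by linarith
    then have "form k (monom 1 a * v) = (\<Sum>n\<le>degree v + a. hom (coeff (monom 1 a * v) n) * g k n)"
      by (rule form_superset)
    also have "\<dots> = (\<Sum>n\<in>{a..degree v + a}. hom (coeff (monom 1 a * v) n) * g k n)"
      by (rule sum.mono_neutral_right) (auto simp: coeff_monom_mult)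
    also have "\<dots> = (\<Sum>n\<le>degree v. hom (coeff v n) * g k (n + a))"
      by (rule sum.reindex_bij_witness[of _ "\<lambda>n. n + a" "\<lambda>n. n - a"]) (auto simp: coeff_monom_mult)
    finally show ?thesis by (simp add: B.form_def fps_sum_nth g')
  qed
  have prod: "fps_nth (\<Prod>j = 0..<r. B.form (p j) (vs ! j)) i =
      (\<Sum>a\<in>natpermute i r. \<Prod>j = 0..<r. form (p j) (monom 1 (a ! j) * vs ! j))" for p
  proof (cases r)
    case 0
    have "natpermute i 0 = (if i = 0 then {[]} else {})" by (auto simp: natpermute_def)
    then show ?thesis by (simp add: 0)
  next
    case (Suc l)
    then show ?thesis
      using fps_prod_nth[of "\<lambda>j. B.form (p j) (vs ! j)" l i]
      by (simp add: form atLeastLessThanSuc_atLeastAtMost)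
  qed
  have "B.word_det vs = (\<Sum>p | p permutes {0..<r}. fps_const (signof p) *
      (\<Prod>j = 0..<r. B.form (p j) (vs ! j)))"
    unfolding B.word_det_def det_col[OF B.form_mat_carrier(1)] const.hom_signof
    using len by (auto simp: B.form_mat_def permutes_in_image lessThan_atLeast0 intro!: sum.cong prod.cong)
  then have "fps_nth (B.word_det vs) i = (\<Sum>p | p permutes {0..<r}. signof p *
      (\<Sum>a\<in>natpermute i r. \<Prod>j = 0..<r. form (p j) (monom 1 (a ! j) * vs ! j)))"
    by (simp add: fps_sum_nth prod)
  also have "\<dots> = (\<Sum>a\<in>natpermute i r. \<Sum>p | p permutes {0..<r}. signof p *
      (\<Prod>j = 0..<r. form (p j) (monom 1 (a ! j) * vs ! j)))"
    unfolding sum_distrib_left by (rule sum.swap)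
  also have "\<dots> = (\<Sum>a\<in>natpermute i r. word_det (map2 (\<lambda>k v. monom 1 k * v) a vs))"
  proof (rule sum.cong[OF refl])
    fix a assume "a \<in> natpermute i r"
    then have a: "length a = r" by (simp add: natpermute_def)
    show "(\<Sum>p | p permutes {0..<r}. signof p *
        (\<Prod>j = 0..<r. form (p j) (monom 1 (a ! j) * vs ! j))) =
      word_det (map2 (\<lambda>k v. monom 1 k * v) a vs)"
      unfolding word_det_def det_col[OF form_mat_carrier(1)]
      using len a by (auto simp: form_mat_def permutes_in_image lessThan_atLeast0 intro!: sum.cong prod.cong)
  qed
  finally show ?thesis .
qed

section \<open>The exterior algebra as a module, and its operators\<close>

lemma ext_scale_add: "ext_scale a (u + v) = ext_scale a u + ext_scale a v"
  by transfer (simp add: wscale_add ext_null.zero)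
lemma ext_scale_add_left: "ext_scale (a + b) u = ext_scale a u + ext_scale b u"
  by transfer (simp add: wscale_add_left ext_null.zero)
lemma ext_scale_mult: "ext_scale (a * b) u = ext_scale a (ext_scale b u)"
  by transfer (simp add: wscale_mult ext_null.zero)
lemma ext_scale_one [simp]: "ext_scale 1 u = u"
  by transfer (simp add: ext_null.zero)
lemma ext_scale_zero [simp]: "ext_scale 0 u = 0" "ext_scale a 0 = 0"
  by (transfer, simp add: ext_null.zero)+
lemma ext_scale_minus_one: "ext_scale (- 1) u = - u"
  by transfer (simp add: wscale_uminus ext_null.zero)
lemma ext_scale_sum: "ext_scale a (\<Sum>i\<in>A. f i) = (\<Sum>i\<in>A. ext_scale a (f i))"
  by (induction A rule: infinite_finite_induct) (auto simp: ext_scale_add)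

lemma abs_ext_add: "abs_ext (x + y) = abs_ext x + abs_ext y"
  by (simp add: plus_ext.abs_eq)
lemma abs_ext_scale: "abs_ext (wscale a x) = ext_scale a (abs_ext x)"
  by (simp add: ext_scale.abs_eq)
lemma abs_ext_zero: "abs_ext 0 = 0"
  by (simp add: zero_ext_def)
lemma abs_ext_sum: "abs_ext (\<Sum>i\<in>A. f i) = (\<Sum>i\<in>A. abs_ext (f i))"
  by (induction A rule: infinite_finite_induct) (auto simp: abs_ext_add abs_ext_zero)

lemma wedge_add: "wedge (us @ (v + w) # ws) = wedge (us @ v # ws) + wedge (us @ w # ws)"
  using ext_null.lin_add[of us v w ws]
  by (simp add: wedge_def ext.abs_eq_iff diff_diff_eq flip: abs_ext_add)
lemma wedge_smult: "wedge (us @ Polynomial.smult a v # ws) = ext_scale a (wedge (us @ v # ws))"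
  using ext_null.lin_smult[of us a v ws]
  by (simp add: wedge_def ext.abs_eq_iff flip: abs_ext_scale)
lemma wedge_alt: "wedge (us @ v # v # ws) = 0"
  using ext_null.alt[of us v ws] by (simp add: wedge_def ext.abs_eq_iff flip: abs_ext_zero)
lemma wedge_swap: "wedge (us @ v # w # ws) = - wedge (us @ w # v # ws)"
  using word_swap_null[of us v w ws]
  by (simp add: wedge_def ext.abs_eq_iff eq_neg_iff_add_eq_0 flip: abs_ext_add abs_ext_zero)

lemma words_expand: "(\<Sum>vs\<in>Poly_Mapping.keys x. wscale (Poly_Mapping.lookup x vs) (word vs)) = x"
  by (rule poly_mapping_eqI)
    (auto simp: lookup_sum lookup_single when_def in_keys_iff if_distrib cong: if_cong)

text \<open>
  Every element of the exterior power is a combination of wedges; this gives the induction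
  principle on which the proofs about linear maps rest.
\<close>

lemma ext_power_induct [consumes 1, case_names zero add scale]:
  assumes "u \<in> ext_power r" and "P 0" and "\<And>u v. P u \<Longrightarrow> P v \<Longrightarrow> P (u + v)"
    and "\<And>a vs. length vs = r \<Longrightarrow> P (ext_scale a (wedge vs))"
  shows "P u"
proof -
  obtain x where u: "u = abs_ext x" and x: "\<forall>vs\<in>Poly_Mapping.keys x. length vs = r"
    using assms(1) by (auto simp: ext_power_def)
  have "u = (\<Sum>vs\<in>Poly_Mapping.keys x. ext_scale (Poly_Mapping.lookup x vs) (wedge vs))"
    unfolding u by (subst words_expand[symmetric]) (simp add: abs_ext_sum abs_ext_scale wedge_def)
  moreover have "P (\<Sum>vs\<in>A. ext_scale (Poly_Mapping.lookup x vs) (wedge vs))"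
    if "A \<subseteq> Poly_Mapping.keys x" for A
    using that by (induction A rule: infinite_finite_induct) (auto simp: assms x)
  ultimately show ?thesis by simp
qed

lemma ext_power_zero: "0 \<in> ext_power r"
  unfolding ext_power_def by (auto intro!: exI[of _ 0] simp: abs_ext_zero)
lemma ext_power_add: "u \<in> ext_power r \<Longrightarrow> v \<in> ext_power r \<Longrightarrow> u + v \<in> ext_power r"
proof -
  assume "u \<in> ext_power r" "v \<in> ext_power r"
  then obtain x y where "u = abs_ext x" "v = abs_ext y"
    "\<forall>vs\<in>Poly_Mapping.keys x. length vs = r" "\<forall>vs\<in>Poly_Mapping.keys y. length vs = r"
    by (auto simp: ext_power_def)
  then show ?thesis
    unfolding ext_power_def using Poly_Mapping.keys_add[of x y]
    by (auto intro!: exI[of _ "x + y"] simp: abs_ext_add)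
qed
lemma ext_power_scale: "u \<in> ext_power r \<Longrightarrow> ext_scale a u \<in> ext_power r"
proof -
  assume "u \<in> ext_power r"
  then obtain x where x: "u = abs_ext x" "\<forall>vs\<in>Poly_Mapping.keys x. length vs = r"
    by (auto simp: ext_power_def)
  moreover have "Poly_Mapping.keys (wscale a x) \<subseteq> Poly_Mapping.keys x"
    by (auto simp: in_keys_iff)
  ultimately show ?thesis
    unfolding ext_power_def by (auto intro!: exI[of _ "wscale a x"] simp: abs_ext_scale)
qed
lemma ext_power_sum: "(\<And>i. i \<in> A \<Longrightarrow> f i \<in> ext_power r) \<Longrightarrow> (\<Sum>i\<in>A. f i) \<in> ext_power r"
  by (induction A rule: infinite_finite_induct) (auto simp: ext_power_zero ext_power_add)
lemma ext_power_wedge: "length vs = r \<Longrightarrow> wedge vs \<in> ext_power r"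
  unfolding ext_power_def wedge_def by auto

lemma wedge_left_add: "wedge_left w (u + v) = wedge_left w u + wedge_left w v"
  by transfer (simp add: word_ext_add ext_null.zero)
lemma wedge_left_scale: "wedge_left w (ext_scale a u) = ext_scale a (wedge_left w u)"
  by transfer (simp add: word_ext_scale ext_null.zero)
lemma wedge_left_wedge: "wedge_left w (wedge vs) = wedge (w # vs)"
  by (simp add: wedge_def wedge_left.abs_eq wedge_left_word_def)

lemma contract_add: "contract j (u + v) = contract j u + contract j v"
  by transfer (simp add: word_ext_add ext_null.zero)
lemma contract_scale: "contract j (ext_scale a u) = ext_scale a (contract j u)"
  by transfer (simp add: word_ext_scale ext_null.zero)
lemma contract_wedge: "contract j (wedge vs) =
    (\<Sum>k<length vs. ext_scale ((-1) ^ k * coeff (vs ! k) j) (wedge (take k vs @ drop (Suc k) vs)))"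
  by (simp add: wedge_def contract.abs_eq contract_word_def abs_ext_sum abs_ext_scale)

lemma sigma_add: "sigma j (u + v) = sigma j u + sigma j v"
  by transfer (simp add: word_ext_add ext_null.zero)
lemma sigma_scale: "sigma j (ext_scale a u) = ext_scale a (sigma j u)"
  by transfer (simp add: word_ext_scale ext_null.zero)
lemma sigma_wedge: "sigma i (wedge vs) =
    (\<Sum>a\<in>natpermute i (length vs). wedge (map2 (\<lambda>k v. monom 1 k * v) a vs))"
  by (simp add: wedge_def sigma.abs_eq sigma_word_def abs_ext_sum natpermute_def)

lemma wedge_left_zero: "wedge_left w 0 = 0"
  using wedge_left_add[of w 0 0] by simp
lemma wedge_left_sum: "wedge_left w (\<Sum>i\<in>A. f i) = (\<Sum>i\<in>A. wedge_left w (f i))"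
  by (induction A rule: infinite_finite_induct) (auto simp: wedge_left_add wedge_left_zero)
lemma contract_zero: "contract j 0 = 0"
  using contract_add[of j 0 0] by simp
lemma sigma_zero: "sigma j 0 = 0"
  using sigma_add[of j 0 0] by simp

lemma sigma_ext_power:
  assumes "u \<in> ext_power r" shows "sigma i u \<in> ext_power r"
  using assms
proof (induction rule: ext_power_induct)
  case (scale a vs)
  then show ?case
    by (auto simp: sigma_scale sigma_wedge natpermute_def
        intro!: ext_power_scale ext_power_sum ext_power_wedge)
qed (auto simp: sigma_zero sigma_add ext_power_zero ext_power_add)

lemma wedge_left_contract_ext_power:
  assumes "u \<in> ext_power r" "r > 0" shows "wedge_left w (contract j u) \<in> ext_power r"
  using assms(1)
proof (induction rule: ext_power_induct)
  case (scale a vs)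
  then show ?case using assms(2)
    by (auto simp: contract_scale contract_wedge wedge_left_scale wedge_left_sum wedge_left_wedge
        intro!: ext_power_scale ext_power_sum ext_power_wedge)
qed (auto simp: contract_zero contract_add wedge_left_zero wedge_left_add ext_power_zero ext_power_add)

section \<open>Wedges of decreasing words span the exterior power\<close>

lemma wedge_move:
  "\<exists>s\<in>{1, -1}. wedge (us @ x # vs @ ws) = ext_scale s (wedge (us @ vs @ x # ws))"
proof (induction vs arbitrary: us)
  case Nil
  show ?case by simp
next
  case (Cons v vs)
  obtain s where s: "s \<in> {1, -1}" "wedge ((us @ [v]) @ x # vs @ ws) = ext_scale s (wedge ((us @ [v]) @ vs @ x # ws))"
    using Cons.IH[of "us @ [v]"] by blast
  have "wedge (us @ x # (v # vs) @ ws) = - wedge (us @ v # x # vs @ ws)"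
    using wedge_swap[of us x v "vs @ ws"] by simp
  also have "\<dots> = ext_scale (- s) (wedge (us @ (v # vs) @ x # ws))"
    using s by (simp flip: ext_scale_minus_one ext_scale_mult)
  finally show ?case using s(1) by (intro bexI[of _ "- s"]) auto
qed

text \<open>
  Selection sort by adjacent transpositions; the prefix \<open>us\<close> holds the letters already in place.
\<close>

lemma wedge_permute:
  assumes "mset as = mset bs"
  shows "\<exists>s\<in>{1, -1}. wedge (us @ as) = ext_scale s (wedge (us @ bs))"
  using assms
proof (induction as arbitrary: us bs)
  case Nil
  then show ?case by simp
next
  case (Cons x as)
  have "x \<in> set bs" using Cons.prems by (metis list.set_intros(1) mset_eq_setD)
  then obtain b1 b2 where bs: "bs = b1 @ x # b2" by (meson split_list)
  then have "mset as = mset (b1 @ b2)" using Cons.prems by simp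
  then obtain s where s: "s \<in> {1, -1}"
      "wedge ((us @ [x]) @ as) = ext_scale s (wedge ((us @ [x]) @ b1 @ b2))"
    using Cons.IH by blast
  obtain t where t: "t \<in> {1, -1}" "wedge (us @ x # b1 @ b2) = ext_scale t (wedge (us @ b1 @ x # b2))"
    using wedge_move by blast
  show ?case
    using s t by (intro bexI[of _ "s * t"]) (auto simp: bs simp flip: ext_scale_mult)
qed

lemma wedge_not_distinct:
  assumes "\<not> distinct vs" shows "wedge vs = 0"
proof -
  obtain xs ys zs y where vs: "vs = xs @ [y] @ ys @ [y] @ zs"
    using not_distinct_decomp[OF assms] by blast
  have "mset vs = mset (y # y # xs @ ys @ zs)" by (simp add: vs)
  then obtain s where "wedge ([] @ vs) = ext_scale s (wedge ([] @ y # y # xs @ ys @ zs))"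
    using wedge_permute by blast
  then show ?thesis using wedge_alt[of "[]" y "xs @ ys @ zs"] by simp
qed

text \<open>
  A sequence of monic polynomials of degrees 0, 1, 2, \<open>\<dots>\<close> spans: subtract the leading term. It is
  applied to the monomials \<open>X\<^sup>n\<close> and to the \<open>X\<^sup>n(c)\<close>.
\<close>

lemma poly_monic_sequence_induct:
  fixes p :: "nat \<Rightarrow> 'a::comm_ring_1 poly"
  assumes p: "\<And>n. coeff (p n) n = 1" "\<And>n. degree (p n) \<le> n"
    and "P 0" and "\<And>u v. P u \<Longrightarrow> P v \<Longrightarrow> P (u + v)"
    and "\<And>a n. P (Polynomial.smult a (p n))"
  shows "P v"
proof -
  have "degree v < N \<Longrightarrow> P v" for N
  proof (induction N arbitrary: v)
    case (Suc N)
    define w where "w = v - Polynomial.smult (coeff v N) (p N)"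
    have "coeff w n = 0" if "n \<ge> N" for n
    proof (cases "n = N")
      case False
      then show ?thesis
        using that Suc.prems p(2)[of N] by (simp add: w_def coeff_eq_0)
    qed (simp add: w_def p(1))
    then have "w = 0 \<or> degree w < N"
      by (metis leading_coeff_0_iff linorder_not_less)
    then have "P w" using Suc.IH assms(3) by auto
    then have "P (w + Polynomial.smult (coeff v N) (p N))" using assms(4,5) by blast
    then show ?case by (simp add: w_def)
  qed simp
  then show ?thesis by blast
qed

text \<open>
  Multilinearity reduces to words in the \<open>p n\<close>. Sorting such a word changes at most its sign, and
  a repeated letter makes it vanish.
\<close>

lemma ext_power_span:
  fixes p :: "nat \<Rightarrow> 'a::comm_ring_1 poly"
  assumes p: "\<And>n. coeff (p n) n = 1" "\<And>n. degree (p n) \<le> n"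
    and P: "P 0" "\<And>u v. P u \<Longrightarrow> P v \<Longrightarrow> P (u + v)" "\<And>a u. P u \<Longrightarrow> P (ext_scale a u)"
    and dec: "\<And>as. sorted_wrt (>) as \<Longrightarrow> length as = r \<Longrightarrow> P (wedge (map p as))"
    and u: "u \<in> ext_power r"
  shows "P u"
proof -
  have 1: "P (wedge (map p as))" if "length as = r" for as
  proof (cases "distinct as")
    case True
    define bs where "bs = rev (sort as)"
    have "sorted_wrt (>) bs" using True
      by (simp add: bs_def sorted_wrt_rev strict_sorted_iff)
    moreover have len: "length bs = r" by (simp add: bs_def that)
    moreover have "mset (map p as) = mset (map p bs)" by (simp add: bs_def)
    then obtain s where "wedge ([] @ map p as) = ext_scale s (wedge ([] @ map p bs))"
      using wedge_permute by blast
    ultimately show ?thesis using dec P(3) by simp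
  next
    case False
    then have "\<not> distinct (map p as)" by (auto simp: distinct_map)
    then show ?thesis using wedge_not_distinct P(1) by metis
  qed
  \<comment> \<open>The letters of an arbitrary word are expanded from left to right in terms of the \<open>p n\<close>.\<close>
  have 2: "P (wedge (map p as @ vs))" if "length as + length vs = r" for as vs
    using that
  proof (induction vs arbitrary: as)
    case Nil
    then show ?case using 1 by simp
  next
    case (Cons v vs)
    show ?case
    proof (rule poly_monic_sequence_induct[of p "\<lambda>v. P (wedge (map p as @ v # vs))", OF p])
      show "P (wedge (map p as @ 0 # vs))"
        using wedge_smult[of "map p as" 0 0 vs] P(1) by simp
      show "P (wedge (map p as @ Polynomial.smult a (p n) # vs))" for a n
        using Cons.IH[of "as @ [n]"] Cons.prems by (simp add: wedge_smult P(3))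
    qed (simp add: wedge_add P(2))
  qed
  show ?thesis using u
    by (induction rule: ext_power_induct) (use 2[of "[]"] P in auto)
qed

section \<open>The determinantal map into the ring of the \<open>h\<^sub>i\<close>\<close>

lemma base_const_hom: "comm_ring_hom (base_const :: 'n::enum base \<Rightarrow> ('r::enum, 'n) rpoly)"
  by unfold_locales (simp_all add: base_const_def single_add mult_single)

definition h_at :: "int \<Rightarrow> ('r::enum, 'n::enum) rpoly" where
  "h_at j = (if j < 0 then 0 else h_var (nat j))"

lemma h_at_neg [simp]: "j < 0 \<Longrightarrow> h_at j = 0"
  by (simp add: h_at_def)

lemma evar_zero: "evar 0 = 1" and evar_big: "i > CARD('r) \<Longrightarrow> (evar i :: ('r::enum, 'n::enum) rpoly) = 0"
  by (auto simp: evar_def variable_def)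

lemma cvar_zero: "cvar 0 = 1"
  by (simp add: cvar_def variable_def)

lemma E_series_inv: "E_series * (E_inv :: ('r::enum, 'n::enum) rpoly fps) = 1"
  unfolding E_inv_def by (rule fps_right_inverse) (simp add: E_series_def evar_zero)

lemma h_var_zero: "h_var 0 = (1 :: ('r::enum, 'n::enum) rpoly)"
  using arg_cong[OF E_series_inv, of "\<lambda>F. fps_nth F 0"]
  by (simp add: h_var_def E_series_def evar_zero)

lemma e_h_recurrence:
  assumes "m \<ge> 1"
  shows "(\<Sum>i\<le>m. (- 1) ^ i * evar i * h_var (m - i) :: ('r::enum, 'n::enum) rpoly) = 0"
  using arg_cong[OF E_series_inv, of "\<lambda>F. fps_nth F m"] assms
  by (simp add: fps_mult_nth E_series_def h_var_def atLeast0AtMost)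

text \<open>
  The recurrence between the \<open>e\<^sub>i\<close> and \<open>h\<^sub>j\<close> may be summed up to any bound that is at least \<open>r\<close>,
  because \<open>e\<^sub>i\<close> vanishes beyond \<open>r\<close> and \<open>h\<^sub>j\<close> vanishes for negative \<open>j\<close>.
\<close>

lemma e_h_recurrence_from:
  assumes "m \<ge> 1" "N \<ge> CARD('r)"
  shows "(\<Sum>i\<le>N. (- 1) ^ i * evar i * h_at (int m - int i) :: ('r::enum, 'n::enum) rpoly) = 0"
proof -
  let ?f = "\<lambda>i. (- 1) ^ i * evar i * h_at (int m - int i) :: ('r, 'n) rpoly"
  have "sum ?f {..N} = sum ?f {..max N m}"
    by (rule sum.mono_neutral_left) (use assms in \<open>auto simp: evar_big\<close>)
  also have "\<dots> = sum ?f {..m}"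
    by (rule sum.mono_neutral_right) auto
  also have "\<dots> = (\<Sum>i\<le>m. (- 1) ^ i * evar i * h_var (m - i))"
    by (rule sum.cong) (auto simp: h_at_def simp flip: of_nat_diff)
  also have "\<dots> = 0"
    by (rule e_h_recurrence[OF assms(1)])
  finally show ?thesis .
qed

text \<open>
  The value \<open>h\<^bsub>n-r+k+1\<^esub>\<close> of the \<open>k\<close>-th form on \<open>X\<^sup>n\<close>, with \<open>k\<close> counted from 0. With these forms
  the determinant of \<open>[X(c)]\<^sub>\<lambda>\<close> is the Jacobi-Trudi determinant, by definition.
\<close>

definition h_row :: "nat \<Rightarrow> nat \<Rightarrow> ('r::enum, 'n::enum) rpoly" where
  "h_row k n = h_at (int n + int k + 1 - int CARD('r))"

interpretation phi: form_family "base_const :: 'n::enum base \<Rightarrow> ('r::enum, 'n) rpoly" "CARD('r)" h_row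
  by (simp add: form_family_def base_const_hom)

definition h_tail :: "nat \<Rightarrow> nat \<Rightarrow> ('r::enum, 'n::enum) rpoly fps" where
  "h_tail k n = Abs_fps (\<lambda>a. h_row k (n + a))"

text \<open>
  Multiplying the tail \<open>\<Sum>\<^sub>a h\<^bsub>n+a\<^esub> z\<^sup>a\<close> by \<open>E\<^sub>r(z)\<close> leaves a combination of \<open>h\<^sub>n, \<dots>, h\<^bsub>n-r+1\<^esub>\<close>
  whose coefficients do not depend on \<open>n\<close>. These are the coefficients of all terms but the first,
  which has coefficient 1.
\<close>

definition tail_relation :: "nat \<Rightarrow> ('r::enum, 'n::enum) rpoly fps" where
  "tail_relation j = Abs_fps (\<lambda>a. if a = 0 then 0 else
     - ((- 1) ^ (CARD('r) - 1 + a - j) * evar (CARD('r) - 1 + a - j)))"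

lemma h_tail_step:
  "h_tail k n - fps_X * h_tail (Suc k) n = fps_const (h_row k n :: ('r::enum, 'n::enum) rpoly)"
proof (rule fps_ext)
  fix a show "fps_nth (h_tail k n - fps_X * h_tail (Suc k) n) a = fps_nth (fps_const (h_row k n :: ('r, 'n) rpoly)) a"
    by (cases a) (simp_all add: h_tail_def h_row_def algebra_simps)
qed

lemma h_tail_last:
  fixes n :: nat
  defines "l \<equiv> CARD('r::enum) - 1"
  shows "E_series * h_tail l n = 
    fps_const (h_row l n :: ('r, 'n::enum) rpoly) + (\<Sum>j<l. tail_relation j * fps_const (h_row j n))"
proof (rule fps_ext)
  fix a
  have r: "CARD('r) = Suc l" using l_def by simp
  let ?s = "\<lambda>i. (- 1) ^ i * evar i :: ('r, 'n) rpoly"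
  have lhs: "fps_nth (E_series * h_tail l n) a = (\<Sum>i\<le>a. ?s i * h_at (int (n + a) - int i))"
    unfolding fps_mult_nth
    by (rule sum.cong) (auto simp: E_series_def h_tail_def h_row_def r of_nat_diff algebra_simps)
  show "fps_nth (E_series * h_tail l n) a = fps_nth (fps_const (h_row l n :: ('r, 'n) rpoly) +
      (\<Sum>j<l. tail_relation j * fps_const (h_row j n))) a"
  proof (cases "a = 0")
    case True
    then show ?thesis unfolding lhs by (simp add: evar_zero h_row_def r fps_sum_nth tail_relation_def)
  next
    case False
    have "(\<Sum>j<l. ?s (l + a - j) * h_row j n) = (\<Sum>i\<in>{a<..a + l}. ?s i * h_at (int (n + a) - int i))"
      by (rule sum.reindex_bij_witness[of _ "\<lambda>i. l + a - i" "\<lambda>j. l + a - j"])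
        (auto simp: h_row_def r of_nat_diff algebra_simps)
    moreover have "(\<Sum>i\<le>a. ?s i * h_at (int (n + a) - int i)) + (\<Sum>i\<in>{a<..a + l}. ?s i * h_at (int (n + a) - int i))
        = (\<Sum>i\<le>a + l. ?s i * h_at (int (n + a) - int i))"
      by (subst sum.union_disjoint[symmetric]) (auto intro!: sum.cong)
    moreover have "\<dots> = 0"
      by (rule e_h_recurrence_from) (use False r in auto)
    ultimately show ?thesis unfolding lhs using False
      by (simp add: fps_sum_nth tail_relation_def r sum_negf eq_neg_iff_add_eq_0)
  qed
qed

text \<open>
  The series \<open>M\<^sub>k(v) = \<Sum>\<^sub>a L\<^sub>k(X\<^sup>a v) z\<^sup>a\<close> satisfy \<open>M\<^sub>k - z M\<^bsub>k+1\<^esub> = L\<^sub>k\<close> for \<open>k < r\<close>, since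
  shifting \<open>X\<^sup>a\<close> and shifting the row are the same for \<open>h\<^bsub>a-r+k\<^esub>\<close>, and \<open>E\<^sub>r(z) M\<^sub>r = L\<^sub>r + \<dots>\<close> with
  earlier \<open>L\<^sub>k\<close> in the remainder. So \<open>M\<close> and \<open>L\<close> are related by triangular matrices of determinant
  \<open>E\<^sub>r(z)\<close> and 1. Hence the generating function of the \<open>\<sigma>\<^sub>i\<close> becomes multiplication by \<open>1/E\<^sub>r(z)\<close>,
  the generating function of the \<open>h\<^sub>i\<close>.
\<close>

lemma phi_sigma_wedge:
  fixes vs :: "'n::enum base poly list"
  assumes len: "length vs = CARD('r::enum)"
  shows "(phi.ext_det (sigma i (wedge vs)) :: ('r, 'n) rpoly) = h_var i * phi.ext_det (wedge vs)"
proof -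
  define l where "l = CARD('r) - 1"
  have r: "CARD('r) = Suc l" using l_def by simp
  define T :: "nat \<Rightarrow> nat \<Rightarrow> ('r, 'n) rpoly fps" where
    "T k m = (if k < l then if m = k then 1 else if m = Suc k then - fps_X else 0
              else if m = k then E_series else 0)" for k m
  define T' :: "nat \<Rightarrow> nat \<Rightarrow> ('r, 'n) rpoly fps" where
    "T' k m = (if m = k then 1 else if k < l then 0 else tail_relation m)" for k m
  let ?M = "\<lambda>T. mat CARD('r) CARD('r) (\<lambda>(k, m). T k m) :: ('r, 'n) rpoly fps mat"
  let ?D = "form_family.word_det (\<lambda>a. fps_const (base_const a)) CARD('r) h_tail vs :: ('r, 'n) rpoly fps"
  have detT: "Determinant.det (?M T) = E_series"
  proof -
    have "Determinant.det (?M T) = prod_list (diag_mat (?M T))"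
      by (rule det_upper_triangular[where n = "CARD('r)"]) (auto simp: T_def r)
    also have "\<dots> = (\<Prod>k\<in>{0..<Suc l}. T k k)"
      by (simp add: prod_list_diag_prod r del: prod.op_ivl_Suc)
    also have "\<dots> = E_series" by (simp add: T_def)
    finally show ?thesis .
  qed
  have detT': "Determinant.det (?M T') = 1"
  proof -
    have "Determinant.det (?M T') = prod_list (diag_mat (?M T'))"
      by (rule det_lower_triangular[where n = "CARD('r)"]) (auto simp: T'_def r)
    also have "\<dots> = 1"
      by (simp add: prod_list_diag_prod r T'_def)
    finally show ?thesis .
  qed
  have const: "comm_ring_hom (fps_const :: ('r, 'n) rpoly \<Rightarrow> _)"
    by unfold_locales (simp_all flip: fps_const_add fps_const_mult)
  have const_base: "comm_ring_hom (\<lambda>a. fps_const (base_const a) :: ('r, 'n) rpoly fps)"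
    by unfold_locales (simp_all add: phi.hom_add phi.hom_mult flip: fps_const_add fps_const_mult)
  have rel: "(\<Sum>m<CARD('r). T k m * h_tail m n) = (\<Sum>m<CARD('r). T' k m * fps_const (h_row m n))"
    if "k < CARD('r)" for k n
  proof (cases "k < l")
    case True
    have "(\<Sum>m<CARD('r). T k m * h_tail m n) = (\<Sum>m\<in>{k, Suc k}. T k m * h_tail m n)"
      by (rule sum.mono_neutral_right) (use True r in \<open>auto simp: T_def\<close>)
    also have "\<dots> = fps_const (h_row k n)"
      using True h_tail_step[of k n, where 'r='r and 'n='n] by (simp add: T_def)
    also have "\<dots> = (\<Sum>m\<in>{k}. T' k m * fps_const (h_row m n))"
      by (simp add: T'_def)
    also have "\<dots> = (\<Sum>m<CARD('r). T' k m * fps_const (h_row m n))"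
      by (rule sum.mono_neutral_left) (use True r in \<open>auto simp: T'_def\<close>)
    finally show ?thesis .
  next
    case False
    then have k: "k = l" using that r by simp
    have "(\<Sum>m<CARD('r). T k m * h_tail m n) = E_series * h_tail l n"
      by (simp add: r k T_def)
    also have "\<dots> = (\<Sum>m<CARD('r). T' k m * fps_const (h_row m n))"
      using h_tail_last[of n, where 'r='r and 'n='n] by (simp add: r k T'_def)
    finally show ?thesis .
  qed
  have "E_series * ?D = fps_const (phi.word_det vs)"
    using word_det_change[OF phi.comm_ring_hom_axioms const_base const refl, where g' = h_tail
        and T = T and T' = T', OF rel len]
    by (simp add: detT detT')
  then have "E_inv * (E_series * ?D) = E_inv * fps_const (phi.word_det vs)" by simp
  then have "?D = E_inv * fps_const (phi.word_det vs)"
    using E_series_inv[where 'r='r and 'n='n] by (simp add: mult.assoc[symmetric] mult.commute[of E_inv])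
  then have "fps_nth ?D i = h_var i * phi.word_det vs"
    by (simp add: h_var_def)
  then show ?thesis
    using phi.shift_word_det_nth[of "h_tail :: nat \<Rightarrow> nat \<Rightarrow> ('r, 'n) rpoly fps" vs i] len
    by (simp add: sigma_wedge phi.ext_det_sum phi.ext_det_wedge h_tail_def)
qed

lemma phi_sigma:
  assumes "u \<in> ext_power CARD('r::enum)"
  shows "(phi.ext_det (sigma i u) :: ('r, 'n::enum) rpoly) = h_var i * phi.ext_det u"
  using assms
  by (induction rule: ext_power_induct)
    (auto simp: sigma_zero sigma_add sigma_scale phi.ext_det_zero phi.ext_det_add phi.ext_det_scale
      phi_sigma_wedge distrib_left mult_ac)

lemma degree_Xc: "degree (Xc n) \<le> n" and coeff_Xc_top: "coeff (Xc n) n = 1"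
proof -
  show "degree (Xc n) \<le> n"
    unfolding Xc_def by (intro degree_sum_le) (auto intro: order_trans[OF degree_monom_le])
  have "coeff (Xc n) n = (\<Sum>i\<le>n. if i = 0 then 1 else 0)"
    unfolding Xc_def coeff_sum coeff_monom by (rule sum.cong) (auto simp: cvar_zero)
  then show "coeff (Xc n) n = 1" by simp
qed

text \<open>
  The defining sum of \<open>X\<^sup>a(c)\<close> stops at \<open>i = a\<close>, whereas the one of \<open>h\<^sub>j(c)\<close> stops at \<open>i = j\<close>.
  They agree because \<open>j = a - r + k + 1 \<le> a\<close> and the \<open>h\<close> with negative index vanish.
\<close>

lemma phi_form_Xc:
  assumes "k < CARD('r::enum)"
  shows "(phi.form k (Xc a) :: ('r, 'n::enum) rpoly) = hc (int a + int k + 1 - int CARD('r))"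
proof -
  let ?j = "int a + int k + 1 - int CARD('r)"
  have 1: "(phi.form k (Xc a) :: ('r, 'n) rpoly) =
     (\<Sum>i\<le>a. (- 1) ^ i * base_const (cvar i) * h_at (?j - int i))"
    unfolding Xc_def phi.form_sum phi.form_monom
    by (rule sum.cong) (auto simp: phi.hom_mult phi.hom_power phi.hom_uminus h_row_def algebra_simps of_nat_diff)
  show ?thesis
  proof (cases "?j < 0")
    case True
    then show ?thesis by (simp add: 1 hc_def)
  next
    case False
    then obtain m where m: "?j = int m" by (metis nonneg_int_cases linorder_not_less)
    have "m \<le> a" using m assms by linarith
    have "(\<Sum>i\<le>a. (- 1) ^ i * base_const (cvar i) * h_at (?j - int i) :: ('r, 'n) rpoly) =
       (\<Sum>i\<le>m. (- 1) ^ i * base_const (cvar i) * h_at (?j - int i))"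
      by (rule sum.mono_neutral_right) (use \<open>m \<le> a\<close> m in auto)
    also have "\<dots> = (\<Sum>i\<le>m. (- 1) ^ i * base_const (cvar i) * h_var (m - i))"
      by (rule sum.cong) (auto simp: m h_at_def simp flip: of_nat_diff)
    also have "\<dots> = hc ?j"
      by (simp add: m hc_def fps_mult_nth c_series_def h_var_def atLeast0AtMost)
    finally show ?thesis using 1 by simp
  qed
qed

lemma phi_Xwedge: "phi.ext_det (Xwedge CARD('r) lam) = (Delta lam :: ('r::enum, 'n::enum) rpoly)"
proof -
  have "phi.form_mat (map (\<lambda>j. Xc (CARD('r) - j + lam j)) [1..<CARD('r) + 1]) =
    mat CARD('r) CARD('r) (\<lambda>(k, j). hc (int (lam (j + 1)) - int (j + 1) + int (k + 1)) :: ('r, 'n) rpoly)"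
    by (rule eq_matI)
      (auto simp: phi.form_mat_def phi_form_Xc of_nat_diff algebra_simps simp del: upt_Suc)
  then show ?thesis
    by (simp add: Xwedge_def phi.ext_det_wedge phi.word_det_def Delta_def det1_def del: upt_Suc)
qed

lemma phi_Xwedge_zero: "phi.ext_det (Xwedge CARD('r) (\<lambda>_. 0)) = (1 :: ('r::enum, 'n::enum) rpoly)"
proof -
  let ?A = "mat CARD('r) CARD('r) (\<lambda>(k, j). hc (int (k + 1) - int (j + 1)) :: ('r, 'n) rpoly)"
  have hc0: "hc 0 = (1 :: ('r, 'n) rpoly)"
    using h_var_zero[where 'r='r and 'n='n]
    by (simp add: hc_def c_series_def cvar_zero h_var_def)
  have "Determinant.det ?A = prod_list (diag_mat ?A)"
    by (rule det_lower_triangular[where n = "CARD('r)"]) (auto simp: hc_def)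
  also have "\<dots> = 1" by (simp add: prod_list_diag_prod hc0)
  finally show ?thesis
    unfolding phi_Xwedge by (simp add: Delta_def det1_def algebra_simps)
qed

section \<open>Generators of the polynomial ring\<close>

lemma poly_mapping_expand:
  "(\<Sum>m\<in>Poly_Mapping.keys f. Poly_Mapping.single m (Poly_Mapping.lookup f m)) = f"
  by (rule poly_mapping_eqI)
    (auto simp: lookup_sum lookup_single when_def in_keys_iff)

lemma single_add_one:
  "Poly_Mapping.single (a + b) 1 = (Poly_Mapping.single a 1 * Poly_Mapping.single b 1 :: _ \<Rightarrow>\<^sub>0 'b::comm_ring_1)"
  by (simp add: mult_single)

lemma single_sum_one:
  "Poly_Mapping.single (\<Sum>x\<in>A. m x) (1 :: 'b::comm_ring_1) = (\<Prod>x\<in>A. Poly_Mapping.single (m x :: 'x \<Rightarrow>\<^sub>0 nat) 1)"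
  by (induction A rule: infinite_finite_induct) (auto simp: single_add_one)

lemma single_power:
  "Poly_Mapping.single (Poly_Mapping.single x k) (1 :: 'b::comm_ring_1) =
     Poly_Mapping.single (Poly_Mapping.single (x :: 'x) (1::nat)) 1 ^ k"
proof (induction k)
  case (Suc k)
  have "Poly_Mapping.single x (Suc k) = Poly_Mapping.single x 1 + Poly_Mapping.single x k"
    by (simp flip: single_add)
  then show ?case using Suc by (simp add: single_add_one)
qed simp

lemma monomial_eq_prod:
  fixes m :: "'x::finite \<Rightarrow>\<^sub>0 nat"
  shows "Poly_Mapping.single m (1 :: 'b::comm_ring_1) =
    (\<Prod>x\<in>UNIV. Poly_Mapping.single (Poly_Mapping.single x 1) 1 ^ Poly_Mapping.lookup m x)"
proof -
  have "(\<Sum>x\<in>UNIV. Poly_Mapping.single x (Poly_Mapping.lookup m x)) = m"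
    by (rule poly_mapping_eqI) (auto simp: lookup_sum lookup_single when_def)
  then show ?thesis
    using single_sum_one[where 'b='b, of "\<lambda>x. Poly_Mapping.single x (Poly_Mapping.lookup m x)" UNIV]
    by (simp only: single_power[symmetric])
qed

lemma ex_evar: "\<exists>j. Poly_Mapping.single (Poly_Mapping.single (x :: 'r::enum) 1) 1 = (evar j :: ('r, 'n::enum) rpoly)"
proof -
  have "x \<in> set (enum_class.enum :: 'r list)" by (simp add: enum_UNIV)
  then obtain i where i: "i < length (enum_class.enum :: 'r list)" "enum_class.enum ! i = x"
    by (auto simp: in_set_conv_nth)
  have "length (enum_class.enum :: 'r list) = CARD('r)"
    by (simp add: card_UNIV_length_enum)
  then show ?thesis using i by (intro exI[of _ "Suc i"]) (simp add: evar_def variable_def)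
qed

text \<open>
  The \<open>h\<^sub>i\<close> generate \<open>B\<^sub>r(c)\<close> over \<open>B\<^sub>0(c)\<close>: the recurrence expresses each \<open>e\<^sub>j\<close> through the \<open>h\<^sub>i\<close>
  and the \<open>e\<^sub>i\<close> with \<open>i < j\<close>, and the monomials in the \<open>e\<^sub>j\<close> span.
\<close>

lemma rpoly_generated [case_names base h add mult]:
  fixes f :: "('r::enum, 'n::enum) rpoly"
  assumes base: "\<And>a. P (base_const a)" and h: "\<And>i. P (h_var i)"
    and add: "\<And>f g. P f \<Longrightarrow> P g \<Longrightarrow> P (f + g)" and mult: "\<And>f g. P f \<Longrightarrow> P g \<Longrightarrow> P (f * g)"
  shows "P f"
proof -
  have zero: "P 0" and one: "P 1" and minus: "P (- 1)"
    using base[of 0] base[of 1] base[of "- 1"] by (simp_all add: phi.hom_uminus)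
  have power: "P (f ^ k)" if "P f" for f k
    by (induction k) (auto simp: one that mult)
  have sum: "P (sum f A)" if "\<And>i. i \<in> A \<Longrightarrow> P (f i)" for A :: "nat set" and f
    using that by (induction A rule: infinite_finite_induct) (auto simp: zero add)
  have sum_monomials: "P (sum f A)" if "\<And>i. i \<in> A \<Longrightarrow> P (f i)" for A :: "('r \<Rightarrow>\<^sub>0 nat) set" and f
    using that by (induction A rule: infinite_finite_induct) (auto simp: zero add)
  have prod: "P (prod f A)" if "\<And>i. i \<in> A \<Longrightarrow> P (f i)" for A :: "'r set" and f
    using that by (induction A rule: infinite_finite_induct) (auto simp: one mult)
  have evar: "P (evar j)" for j
  proof (induction j rule: less_induct)
    case (less j)
    show ?case
    proof (cases "j = 0")
      case False
      let ?S = "\<Sum>i<j. (- 1) ^ i * evar i * h_var (j - i) :: ('r, 'n) rpoly"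
      have "(- 1) ^ j * evar j + ?S = 0"
        using e_h_recurrence[of j, where 'r='r and 'n='n] False
        by (simp add: lessThan_Suc_atMost[symmetric] h_var_zero add.commute)
      then have S: "(- 1) ^ j * evar j = - ?S" by (simp only: eq_neg_iff_add_eq_0)
      have "evar j = ((- 1) ^ j * (- 1) ^ j) * (evar j :: ('r, 'n) rpoly)"
        by (simp flip: power_mult_distrib)
      also have "\<dots> = (- 1) ^ j * (- 1 * ?S)"
        by (simp only: mult.assoc S mult_minus1)
      finally have "evar j = (- 1) ^ j * (- 1 * ?S)" .
      moreover have "P ?S" by (intro sum mult power minus h less.IH) simp
      ultimately show ?thesis using mult[OF power[OF minus] mult[OF minus]] by simp
    qed (simp add: evar_zero one)
  qed
  have "P (Poly_Mapping.single m a)" for m a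
  proof -
    have "Poly_Mapping.single m a = base_const a * Poly_Mapping.single m 1"
      by (simp add: base_const_def mult_single)
    moreover have "P (Poly_Mapping.single m 1)"
      by (subst monomial_eq_prod, intro prod power) (metis ex_evar evar)
    ultimately show ?thesis using mult[OF base] by metis
  qed
  then show ?thesis by (subst poly_mapping_expand[symmetric]) (rule sum_monomials)
qed

text \<open>
  The image contains 1 and is stable under multiplication by the generators of the ring.
\<close>

lemma phi_surj: "\<exists>u\<in>ext_power CARD('r). phi.ext_det u = (f :: ('r::enum, 'n::enum) rpoly)"
proof -
  have X0: "Xwedge CARD('r) (\<lambda>_. 0) \<in> (ext_power CARD('r) :: 'n base ext set)"
    unfolding Xwedge_def by (rule ext_power_wedge) simp
  have "\<forall>u\<in>ext_power CARD('r). \<exists>v\<in>ext_power CARD('r). phi.ext_det v = f * phi.ext_det u"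
  proof (induction f rule: rpoly_generated)
    case (base a)
    show ?case
      by (intro ballI bexI[of _ "ext_scale a _"]) (auto simp: ext_power_scale phi.ext_det_scale)
  next
    case (h i)
    show ?case
    proof
      fix u :: "'n base ext" assume "u \<in> ext_power CARD('r)"
      then show "\<exists>v\<in>ext_power CARD('r). phi.ext_det v = (h_var i :: ('r, 'n) rpoly) * phi.ext_det u"
        using phi_sigma[where 'r='r and u = u and i = i] sigma_ext_power[of u _ i] by blast
    qed
  next
    case (add f g)
    show ?case
    proof
      fix u :: "'n base ext" assume "u \<in> ext_power CARD('r)"
      then obtain v w where "v \<in> ext_power CARD('r)" "phi.ext_det v = f * phi.ext_det u"
        "w \<in> ext_power CARD('r)" "phi.ext_det w = g * phi.ext_det u"
        using add by blast
      then show "\<exists>v\<in>ext_power CARD('r). phi.ext_det v = (f + g) * phi.ext_det u"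
        by (intro bexI[of _ "v + w"]) (simp_all add: ext_power_add phi.ext_det_add distrib_right)
    qed
  next
    case (mult f g)
    show ?case
    proof
      fix u :: "'n base ext" assume "u \<in> ext_power CARD('r)"
      then obtain v where v: "v \<in> ext_power CARD('r)" "phi.ext_det v = g * phi.ext_det u"
        using mult by blast
      then obtain w where "w \<in> ext_power CARD('r)" "phi.ext_det w = f * phi.ext_det v"
        using mult by blast
      with v show "\<exists>v\<in>ext_power CARD('r). phi.ext_det v = (f * g) * phi.ext_det u"
        by (intro bexI[of _ w]) (simp_all add: mult.assoc)
    qed
  qed
  then obtain v where "v \<in> ext_power CARD('r)"
      "phi.ext_det v = f * phi.ext_det (Xwedge CARD('r) (\<lambda>_. 0))"
    using X0 by blast
  then show ?thesis by (auto simp: phi_Xwedge_zero)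
qed

section \<open>Alternants\<close>

definition eval_at :: "('a::comm_ring_1 \<Rightarrow> 'b::comm_ring_1) \<Rightarrow> ('x::finite \<Rightarrow> 'b) \<Rightarrow> (('x \<Rightarrow>\<^sub>0 nat) \<Rightarrow>\<^sub>0 'a) \<Rightarrow> 'b" where
  "eval_at c s f = (\<Sum>m\<in>Poly_Mapping.keys f. c (Poly_Mapping.lookup f m) * (\<Prod>x\<in>UNIV. s x ^ Poly_Mapping.lookup m x))"

context comm_ring_hom begin

lemma eval_at_superset:
  "finite A \<Longrightarrow> Poly_Mapping.keys f \<subseteq> A \<Longrightarrow> eval_at hom s f =
     (\<Sum>m\<in>A. hom (Poly_Mapping.lookup f m) * (\<Prod>x\<in>UNIV. s x ^ Poly_Mapping.lookup m x))"
  unfolding eval_at_def by (rule sum.mono_neutral_left) (auto simp: in_keys_iff)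

lemma eval_at_add: "eval_at hom s (f + g) = eval_at hom s f + eval_at hom s g"
proof -
  let ?A = "Poly_Mapping.keys f \<union> Poly_Mapping.keys g"
  have "Poly_Mapping.keys (f + g) \<subseteq> ?A" by (rule Poly_Mapping.keys_add)
  then show ?thesis
    by (simp add: eval_at_superset[of ?A] lookup_add hom_add distrib_right sum.distrib)
qed

lemma eval_at_single: "eval_at hom s (Poly_Mapping.single m a) = hom a * (\<Prod>x\<in>UNIV. s x ^ Poly_Mapping.lookup m x)"
  by (subst eval_at_superset[of "{m}"]) auto

lemma eval_at_sum: "eval_at hom s (\<Sum>i\<in>A. f i) = (\<Sum>i\<in>A. eval_at hom s (f i))"
  by (induction A rule: infinite_finite_induct) (auto simp: eval_at_add eval_at_def[of _ _ 0])

lemma eval_at_mult: "eval_at hom s (f * g) = eval_at hom s f * eval_at hom s g"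
proof -
  let ?t = "\<lambda>f m. Poly_Mapping.single m (Poly_Mapping.lookup f m)"
  have "f * g = (\<Sum>m\<in>Poly_Mapping.keys f. \<Sum>k\<in>Poly_Mapping.keys g. ?t f m * ?t g k)"
    by (simp only: poly_mapping_expand flip: sum_product)
  then have "eval_at hom s (f * g) =
      (\<Sum>m\<in>Poly_Mapping.keys f. \<Sum>k\<in>Poly_Mapping.keys g. eval_at hom s (?t f m) * eval_at hom s (?t g k))"
    by (simp add: eval_at_sum mult_single eval_at_single hom_mult lookup_add power_add prod.distrib mult_ac)
  also have "\<dots> = eval_at hom s (\<Sum>m\<in>Poly_Mapping.keys f. ?t f m) * eval_at hom s (\<Sum>k\<in>Poly_Mapping.keys g. ?t g k)"
    by (simp only: eval_at_sum sum_product)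
  finally show ?thesis by (simp only: poly_mapping_expand)
qed

lemma eval_at_hom: "comm_ring_hom (eval_at hom s)"
proof
  show "eval_at hom s 1 = 1" using eval_at_single[of s 0 1] by simp
qed (auto simp: eval_at_add eval_at_mult eval_at_def[of _ _ 0])

end

type_synonym 'a roots_poly = "(nat \<Rightarrow>\<^sub>0 nat) \<Rightarrow>\<^sub>0 'a"

text \<open>
  The polynomial ring \<open>R[x\<^sub>0, x\<^sub>1, \<dots>]\<close>, in which \<open>E\<^sub>r(z)\<close> will split as \<open>\<Prod> (1 - x\<^sub>i z)\<close>.
  Evaluation of a polynomial at \<open>x\<^sub>i\<close> is the form with value \<open>x\<^sub>i\<^sup>n\<close> on \<open>X\<^sup>n\<close>, so the determinants
  of this family are the alternants \<open>det (v\<^sub>j(x\<^sub>i))\<close>.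
\<close>

definition root_const :: "'a::comm_ring_1 \<Rightarrow> 'a roots_poly" where
  "root_const a = Poly_Mapping.single 0 a"

definition root_power :: "nat \<Rightarrow> nat \<Rightarrow> 'a::comm_ring_1 roots_poly" where
  "root_power i n = Poly_Mapping.single (Poly_Mapping.single i n) 1"

lemma root_const_hom: "comm_ring_hom (root_const :: 'a::comm_ring_1 \<Rightarrow> 'a roots_poly)"
  by unfold_locales (simp_all add: root_const_def single_add mult_single)

interpretation alt: form_family "root_const :: 'a::comm_ring_1 \<Rightarrow> 'a roots_poly" r root_power for r
  by (simp add: form_family_def root_const_hom)

lemma root_power_eq: "root_power i n = root_power i 1 ^ n"
  unfolding root_power_def by (rule single_power)

definition exponent :: "nat list \<Rightarrow> nat \<Rightarrow>\<^sub>0 nat" where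
  "exponent as = (\<Sum>i<length as. Poly_Mapping.single i (as ! i))"

lemma lookup_exponent: "i < length as \<Longrightarrow> Poly_Mapping.lookup (exponent as) i = as ! i"
  by (simp add: exponent_def lookup_sum lookup_single when_def)

lemma decreasing_permuted:
  assumes "sorted_wrt (>) (as :: nat list)" "sorted_wrt (>) bs" "length as = r" "length bs = r"
    and p: "p permutes {0..<r}" and eq: "\<And>i. i < r \<Longrightarrow> as ! (p i) = bs ! i"
  shows "as = bs \<and> p = id"
proof -
  have "set bs = (\<lambda>i. bs ! i) ` {0..<r}" using assms(4) by (auto simp: set_conv_nth)
  also have "\<dots> = (\<lambda>i. as ! i) ` (p ` {0..<r})" unfolding image_image by (rule image_cong) (auto simp: eq)
  also have "\<dots> = set as" using assms(3) permutes_image[OF p] by (auto simp: set_conv_nth)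
  finally have "set bs = set as" .
  then have "rev as = rev bs"
    using strict_sorted_equal[of "rev as" "rev bs"] assms(1,2) by (simp add: sorted_wrt_rev)
  then have ab: "as = bs" by simp
  have "distinct as" using assms(1) strict_sorted_iff[of "rev as"] by (simp add: sorted_wrt_rev)
  then have "p i = i" if "i < r" for i
    using eq[OF that] ab that assms(3) permutes_in_image[OF p, of i] by (simp add: nth_eq_iff_index_eq)
  then have "p = id" using permutes_not_in[OF p] by (auto simp: fun_eq_iff)
  then show ?thesis using ab by simp
qed

text \<open>
  The alternant of a decreasing exponent sequence \<open>as\<close> is a signed sum of the monomials with
  permuted exponents, and only the identity gives decreasing exponents. So the monomials with
  decreasing exponents separate these alternants.
\<close>

lemma alt_coeff:
  assumes as: "sorted_wrt (>) as" "length as = r" and bs: "sorted_wrt (>) bs" "length bs = r"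
  shows "Poly_Mapping.lookup (alt.ext_det r (wedge (map (monom 1) as)) :: 'a::comm_ring_1 roots_poly) (exponent bs)
     = (if as = bs then 1 else 0)"
proof -
  let ?e = "\<lambda>p. \<Sum>i<r. Poly_Mapping.single i (as ! (p i))"
  have e: "?e p = exponent bs \<longleftrightarrow> as = bs \<and> p = id" if p: "p permutes {0..<r}" for p
  proof
    assume eq: "?e p = exponent bs"
    have "as ! (p i) = bs ! i" if "i < r" for i
    proof -
      have "Poly_Mapping.lookup (?e p) i = as ! p i"
        using that by (simp add: lookup_sum lookup_single when_def)
      then show ?thesis using eq that bs(2) lookup_exponent[of i bs] by simp
    qed
    then show "as = bs \<and> p = id" using decreasing_permuted as bs p by blast
  next
    assume "as = bs \<and> p = id" then show "?e p = exponent bs" using as by (simp add: exponent_def)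
  qed
  have "alt.ext_det r (wedge (map (monom 1) as)) = 
      (\<Sum>p | p permutes {0..<r}. signof p * (\<Prod>i = 0..<r. root_power i (as ! p i)) :: 'a roots_poly)"
    unfolding alt.ext_det_wedge alt.word_det_def det_def'[OF alt.form_mat_carrier(1)]
    using as by (auto simp: alt.form_mat_def alt.form_monom intro!: sum.cong prod.cong)
  also have "\<dots> = (\<Sum>p | p permutes {0..<r}. Poly_Mapping.single (?e p) (signof p))"
  proof (rule sum.cong[OF refl])
    fix p
    have "(\<Prod>i = 0..<r. root_power i (as ! p i)) = (Poly_Mapping.single (?e p) 1 :: 'a roots_poly)"
      unfolding root_power_def single_sum_one lessThan_atLeast0 ..
    moreover have "signof p = (root_const (signof p) :: 'a roots_poly)" by (rule alt.hom_signof[symmetric])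
    ultimately have "signof p * (\<Prod>i = 0..<r. root_power i (as ! p i)) =
        (root_const (signof p) * Poly_Mapping.single (?e p) 1 :: 'a roots_poly)" by metis
    then show "signof p * (\<Prod>i = 0..<r. root_power i (as ! p i)) = (Poly_Mapping.single (?e p) (signof p) :: 'a roots_poly)"
      by (simp only: root_const_def mult_single add_0 mult_1_right)
  qed
  finally have "Poly_Mapping.lookup (alt.ext_det r (wedge (map (monom 1) as)) :: 'a roots_poly) (exponent bs) =
     (\<Sum>p | p permutes {0..<r}. if as = bs \<and> p = id then signof p else 0)"
    by (simp add: lookup_sum lookup_single when_def e)
  also have "\<dots> = (if as = bs then 1 else 0)"
    by (simp add: sum.delta finite_permutations permutes_id)
  finally show ?thesis .
qed

text \<open>
  By the spanning result an element is a combination of wedges of decreasing sequences of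
  monomials, and its coefficients can be read off from its alternant.
\<close>

lemma alt_inj:
  fixes u :: "'a::comm_ring_1 ext"
  assumes u: "u \<in> ext_power r" and 0: "alt.ext_det r u = 0"
  shows "u = 0"
proof -
  let ?w = "\<lambda>as. wedge (map (monom 1) as) :: 'a ext"
  define D where "D = {as :: nat list. sorted_wrt (>) as \<and> length as = r}"
  define P where "P v \<longleftrightarrow> (\<exists>A c. finite A \<and> A \<subseteq> D \<and> v = (\<Sum>as\<in>A. ext_scale (c as) (?w as)))" for v
  have P_zero: "P 0" unfolding P_def by (rule exI[of _ "{}"]) simp
  have P_scale: "P (ext_scale a v)" if v: "P v" for a v
  proof -
    obtain A c where "finite A" "A \<subseteq> D" "v = (\<Sum>as\<in>A. ext_scale (c as) (?w as))"
      using v unfolding P_def by blast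
    then show ?thesis
      unfolding P_def
      by (intro exI[of _ A] exI[of _ "\<lambda>as. a * c as"]) (simp add: ext_scale_sum ext_scale_mult)
  qed
  have P_add: "P (v + w)" if v: "P v" and w: "P w" for v w
  proof -
    obtain A c where A: "finite A" "A \<subseteq> D" "v = (\<Sum>as\<in>A. ext_scale (c as) (?w as))"
      using v unfolding P_def by blast
    obtain B d where B: "finite B" "B \<subseteq> D" "w = (\<Sum>as\<in>B. ext_scale (d as) (?w as))"
      using w unfolding P_def by blast
    define c' where "c' as = (if as \<in> A then c as else 0)" for as
    define d' where "d' as = (if as \<in> B then d as else 0)" for as
    have "v = (\<Sum>as\<in>A \<union> B. ext_scale (c' as) (?w as))"
      unfolding A(3) by (rule sum.mono_neutral_cong_left) (use A(1) B(1) in \<open>auto simp: c'_def\<close>)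
    moreover have "w = (\<Sum>as\<in>A \<union> B. ext_scale (d' as) (?w as))"
      unfolding B(3) by (rule sum.mono_neutral_cong_left) (use A(1) B(1) in \<open>auto simp: d'_def\<close>)
    ultimately have "v + w = (\<Sum>as\<in>A \<union> B. ext_scale (c' as + d' as) (?w as))"
      by (simp only: ext_scale_add_left sum.distrib)
    then show ?thesis unfolding P_def
      using A(1,2) B(1,2) by (intro exI[of _ "A \<union> B"] exI[of _ "\<lambda>as. c' as + d' as"]) simp
  qed
  have P_basis: "P (?w as)" if "sorted_wrt (>) as" "length as = r" for as
    unfolding P_def
    by (rule exI[of _ "{as}"], rule exI[of _ "\<lambda>_. 1"]) (use that in \<open>simp add: D_def\<close>)
  have "P u"
  proof (rule ext_power_span[where p = "monom 1" and P = P and r = r])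
    show "degree (monom (1 :: 'a) n) \<le> n" for n by (rule degree_monom_le)
  qed (use P_zero P_add P_scale P_basis u in auto)
  then obtain A c where A: "finite A" "A \<subseteq> D" "u = (\<Sum>as\<in>A. ext_scale (c as) (?w as))"
    unfolding P_def by blast
  have lookup_const: "Poly_Mapping.lookup (root_const a * f) m = a * Poly_Mapping.lookup f m"
    for a and f :: "'a roots_poly" and m
    unfolding root_const_def mult_map_scale_conv_mult[symmetric]
    by (simp add: Poly_Mapping.map.rep_eq when_def)
  have "c bs = 0" if bs: "bs \<in> A" for bs
  proof -
    have coeff: "Poly_Mapping.lookup (alt.ext_det r (?w as)) (exponent bs) = (if as = bs then 1 else 0)"
      if "as \<in> A" for as
      by (rule alt_coeff) (use that bs A(2) in \<open>auto simp: D_def\<close>)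
    have "0 = Poly_Mapping.lookup (alt.ext_det r u) (exponent bs)" by (simp add: 0)
    also have "\<dots> = (\<Sum>as\<in>A. c as * Poly_Mapping.lookup (alt.ext_det r (?w as)) (exponent bs))"
      unfolding A(3) alt.ext_det_sum alt.ext_det_scale lookup_sum lookup_const ..
    also have "\<dots> = (\<Sum>as\<in>A. if as = bs then c bs else 0)"
      by (rule sum.cong) (auto simp: coeff)
    also have "\<dots> = c bs" using A(1) bs by simp
    finally show ?thesis by simp
  qed
  then show ?thesis unfolding A(3) by simp
qed

section \<open>Injectivity of the determinantal map\<close>

lemma fps_prod_linear_nth:
  fixes x :: "'i \<Rightarrow> 'b::comm_ring_1"
  assumes "finite S" "j > card S"
  shows "fps_nth (\<Prod>i\<in>S. 1 - fps_const (x i) * fps_X) j = 0"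
  using assms
proof (induction S arbitrary: j rule: finite_induct)
  case (insert i S)
  then obtain k where k: "j = Suc k" by (cases j) auto
  let ?F = "\<Prod>i\<in>S. 1 - fps_const (x i) * fps_X"
  have "(1 - fps_const (x i) * fps_X) * ?F = ?F - fps_const (x i) * (fps_X * ?F)"
    by (simp add: algebra_simps)
  then show ?case using insert by (simp add: k)
qed simp

text \<open>
  Send \<open>e\<^sub>j\<close> to the \<open>j\<close>-th elementary symmetric polynomial of \<open>x\<^sub>0, \<dots>, x\<^bsub>r-1\<^esub>\<close>. Under this
  substitution \<open>\<rho>\<close> the series \<open>1/E\<^sub>r(z)\<close> becomes \<open>\<Prod> 1/(1 - x\<^sub>l z)\<close>, so
  \<open>\<Sum>\<^sub>n x\<^sub>i\<^sup>n z\<^sup>n = 1/(1 - x\<^sub>i z)\<close> is \<open>\<rho>(1/E\<^sub>r(z))\<close> times the polynomial \<open>\<Prod>\<^bsub>l \<noteq> i\<^esub> (1 - x\<^sub>l z)\<close> of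
  degree \<open>r - 1\<close>. Comparing coefficients expresses evaluation at \<open>x\<^sub>i\<close> as a combination of the \<open>r\<close>
  forms with values \<open>\<rho>(h\<^bsub>n-r+k+1\<^esub>)\<close>; the alternant is therefore a multiple of \<open>\<rho>\<close> of the other
  determinant.
\<close>

lemma alternant_factors_through_phi:
  "\<exists>(rho :: ('r::enum, 'n::enum) rpoly \<Rightarrow> 'n base roots_poly) D. comm_ring_hom rho \<and>
    (\<forall>u\<in>ext_power CARD('r). alt.ext_det CARD('r) u = D * rho (phi.ext_det u))"
proof -
  define r where "r = CARD('r)"
  define x :: "nat \<Rightarrow> 'n base roots_poly" where "x i = root_power i 1" for i
  define F where "F S = (\<Prod>i\<in>S. 1 - fps_const (x i) * fps_X)" for S
  \<comment> \<open>The image of the variable \<open>v\<close>, which is \<open>e\<^sub>j\<close> for \<open>j\<close> one more than the position of \<open>v\<close> in the enumeration.\<close>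
  define s where "s = (\<lambda>v :: 'r. let j = Suc (LEAST i. enum_class.enum ! i = v) in (- 1) ^ j * fps_nth (F {..<r}) j)"
  define rho where "rho = eval_at root_const s"
  interpret rho: comm_ring_hom rho unfolding rho_def by (rule alt.eval_at_hom)
  have rho_base: "rho (base_const a) = root_const a" for a
    unfolding rho_def base_const_def by (simp add: alt.eval_at_single)
  have len: "length (enum_class.enum :: 'r list) = r" by (simp add: r_def card_UNIV_length_enum)
  have F0: "fps_nth (F S) 0 = 1" if "finite S" for S
    unfolding F_def using that by (induction S rule: finite_induct) auto
  have Fbig: "fps_nth (F S) j = 0" if "finite S" "j > card S" for S j
    unfolding F_def using that by (rule fps_prod_linear_nth)
  have rho_evar: "rho (evar j) = (- 1) ^ j * fps_nth (F {..<r}) j" for j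
  proof -
    consider "j = 0" | "j > r" | "0 < j" "j \<le> r" by linarith
    then show ?thesis
    proof cases
      case 1
      then show ?thesis using F0[of "{..<r}"] by (simp add: evar_zero)
    next
      case 2
      then have "(evar j :: ('r, 'n) rpoly) = 0" unfolding r_def by (rule evar_big)
      moreover have "fps_nth (F {..<r}) j = 0" by (rule Fbig) (use 2 in auto)
      ultimately show ?thesis by simp
    next
      case j: 3
      define i where "i = j - 1"
      have 3: "j = Suc i" "i < r" using j by (auto simp: i_def)
      let ?v = "enum_class.enum ! i :: 'r"
      have least: "(LEAST k. enum_class.enum ! k = ?v) = i"
      proof (rule Least_equality)
        fix k assume k: "enum_class.enum ! k = ?v"
        show "i \<le> k"
        proof (rule ccontr)
          assume "\<not> i \<le> k"
          then have "k < r" "k \<noteq> i" using 3 by auto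
          then show False using k 3 len enum_distinct[where 'a='r] by (simp add: nth_eq_iff_index_eq)
        qed
      qed simp
      have "evar j = (Poly_Mapping.single (Poly_Mapping.single ?v 1) 1 :: ('r, 'n) rpoly)"
        using 3 by (simp add: evar_def variable_def r_def)
      then have "rho (evar j) = (\<Prod>w\<in>UNIV. s w ^ (1 when ?v = w))"
        unfolding rho_def by (simp only: alt.eval_at_single lookup_single alt.hom_one mult_1)
      also have "\<dots> = (\<Prod>w\<in>UNIV. if w = ?v then s ?v else 1)"
        by (rule prod.cong) (auto simp: when_def)
      also have "\<dots> = s ?v" by simp
      also have "\<dots> = (- 1) ^ j * fps_nth (F {..<r}) j"
        unfolding s_def least Let_def 3(1) ..
      finally show ?thesis .
    qed
  qed
  define H where "H = Abs_fps (\<lambda>n. rho (h_var n))"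
  have rho_E: "rho (fps_nth E_series i) = fps_nth (F {..<r}) i" for i
  proof -
    have "rho (fps_nth E_series i) = (- 1) ^ i * ((- 1) ^ i * fps_nth (F {..<r}) i)"
      by (simp add: E_series_def rho.hom_mult rho.hom_power rho.hom_uminus rho_evar)
    also have "\<dots> = ((- 1) * (- 1)) ^ i * fps_nth (F {..<r}) i"
      by (simp only: power_mult_distrib mult.assoc)
    finally show ?thesis by simp
  qed
  have FH: "F {..<r} * H = 1"
  proof (rule fps_ext)
    fix m
    have "fps_nth (F {..<r} * H) m = (\<Sum>i=0..m. rho (fps_nth E_series i * fps_nth E_inv (m - i)))"
      unfolding fps_mult_nth by (rule sum.cong) (simp_all add: rho.hom_mult rho_E H_def h_var_def)
    also have "\<dots> = rho (fps_nth (E_series * E_inv) m)"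
      by (simp only: fps_mult_nth rho.hom_sum)
    also have "\<dots> = fps_nth 1 m" by (simp add: E_series_inv)
    finally show "fps_nth (F {..<r} * H) m = fps_nth 1 m" .
  qed
  \<comment> \<open>Only \<open>m < r\<close> contributes to the product of \<open>?G\<close> and \<open>H\<close>; the substitution \<open>m = r - 1 - k\<close> turns
  \<open>h\<^bsub>n-m\<^esub>\<close> into the value of the \<open>k\<close>-th form.\<close>
  have root: "root_power i n = (\<Sum>k<r. fps_nth (F ({..<r} - {i})) (r - 1 - k) * rho (h_row k n))"
    if i: "i < r" for i n
  proof -
    let ?G = "F ({..<r} - {i})"
    define P where "P = Abs_fps (\<lambda>n. x i ^ n)"
    have P: "(1 - fps_const (x i) * fps_X) * P = 1"
    proof (rule fps_ext)
      fix m
      have "(1 - fps_const (x i) * fps_X) * P = P - fps_const (x i) * (fps_X * P)"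
        by (simp add: algebra_simps)
      then show "fps_nth ((1 - fps_const (x i) * fps_X) * P) m = fps_nth 1 m"
        by (cases m) (simp_all add: P_def)
    qed
    have F_split: "F {..<r} = (1 - fps_const (x i) * fps_X) * ?G"
      unfolding F_def using i by (subst prod.remove[of _ i]) auto
    have "P = P * (F {..<r} * H)" by (simp only: FH mult_1_right)
    also have "\<dots> = ((1 - fps_const (x i) * fps_X) * P) * (?G * H)" by (simp only: F_split mult_ac)
    finally have "P = ?G * H" by (simp only: P mult_1)
    then have "fps_nth P n = fps_nth (?G * H) n" by (rule arg_cong)
    then have "x i ^ n = (\<Sum>m=0..n. fps_nth ?G m * rho (h_var (n - m)))"
      unfolding fps_mult_nth by (simp only: P_def H_def fps_nth_Abs_fps)
    also have "\<dots> = (\<Sum>m\<le>n. fps_nth ?G m * rho (h_at (int n - int m)))"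
      unfolding atLeast0AtMost by (rule sum.cong) (auto simp: h_at_def simp flip: of_nat_diff)
    also have "\<dots> = (\<Sum>m\<le>max n (r - 1). fps_nth ?G m * rho (h_at (int n - int m)))"
      by (rule sum.mono_neutral_left) auto
    also have "\<dots> = (\<Sum>m\<le>r - 1. fps_nth ?G m * rho (h_at (int n - int m)))"
    proof (rule sum.mono_neutral_right)
      have "fps_nth ?G m = 0" if "r - 1 < m" for m
        by (rule Fbig) (use i that in \<open>auto simp: card_Diff_singleton\<close>)
      then show "\<forall>m\<in>{..max n (r - 1)} - {..r - 1}. fps_nth ?G m * rho (h_at (int n - int m)) = 0"
        by auto
    qed auto
    also have "\<dots> = (\<Sum>k<r. fps_nth ?G (r - 1 - k) * rho (h_row k n))"
    proof (rule sum.reindex_bij_witness[of _ "\<lambda>k. r - 1 - k" "\<lambda>m. r - 1 - m"])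
      fix m assume "m \<in> {..r - 1}"
      then have "m \<le> r - 1" by simp
      then have "int n + int (r - 1 - m) + 1 - int CARD('r) = int n - int m" "r - 1 - (r - 1 - m) = m"
        using i by (auto simp: of_nat_diff r_def[symmetric])
      then show "fps_nth ?G (r - 1 - (r - 1 - m)) * rho (h_row (r - 1 - m) n) =
          fps_nth ?G m * rho (h_at (int n - int m))"
        by (simp only: h_row_def)
    qed (use i in auto)
    finally show ?thesis unfolding x_def root_power_eq[of i n, symmetric] .
  qed
  define Q where "Q i k = fps_nth (F ({..<r} - {i})) (r - 1 - k)" for i k
  define D where "D = Determinant.det (mat r r (\<lambda>(i, k). Q i k))"
  have I: "mat r r (\<lambda>(i, k). if k = i then 1 else 0) = (1\<^sub>m r :: 'n base roots_poly mat)"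
    by (rule eq_matI) auto
  have rel: "(\<Sum>m<r. (if m = i then 1 else 0) * root_power m n) = (\<Sum>k<r. Q i k * rho (h_row k n))"
    if i: "i < r" for i n
  proof -
    have "(\<Sum>m<r. (if m = i then 1 else 0) * root_power m n) = (\<Sum>m<r. if m = i then root_power i n else 0 :: 'n base roots_poly)"
      by (rule sum.cong) auto
    also have "\<dots> = root_power i n" using i by simp
    finally show ?thesis unfolding Q_def root[OF i] .
  qed
  have wd: "alt.word_det r vs = D * rho (phi.word_det vs)" if "length vs = r" for vs
    using word_det_change[OF phi.comm_ring_hom_axioms alt.comm_ring_hom_axioms rho.comm_ring_hom_axioms
        rho_base[symmetric], where T = "\<lambda>i k. if k = i then 1 else 0" and T' = Q
        and g' = root_power and g = h_row and r = r and vs = vs, OF rel that]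
    unfolding I D_def[symmetric] r_def[symmetric] by simp
  have factor: "alt.ext_det r u = D * rho (phi.ext_det u)" if "u \<in> ext_power r" for u
    using that
  proof (induction rule: ext_power_induct)
    case zero
    show ?case by (simp only: alt.ext_det_zero phi.ext_det_zero rho.hom_zero mult_zero_right)
  next
    case (add u v)
    then show ?case by (simp only: alt.ext_det_add phi.ext_det_add rho.hom_add distrib_left)
  next
    case (scale a vs)
    then show ?case
      by (simp only: alt.ext_det_scale phi.ext_det_scale rho.hom_mult rho_base alt.ext_det_wedge
          phi.ext_det_wedge wd mult.left_commute)
  qed
  show ?thesis
    by (intro exI conjI ballI, rule rho.comm_ring_hom_axioms, rule factor[unfolded r_def])
qed

text \<open>
  An element killed by the determinantal map has alternant zero, because the alternant factors
  through it.
\<close>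

lemma phi_inj:
  assumes "u \<in> ext_power CARD('r)" "v \<in> ext_power CARD('r)"
    and "phi.ext_det u = (phi.ext_det v :: ('r::enum, 'n::enum) rpoly)"
  shows "u = v"
proof -
  obtain rho :: "('r, 'n) rpoly \<Rightarrow> 'n base roots_poly" and D where rho: "comm_ring_hom rho"
    "\<forall>u\<in>ext_power CARD('r). alt.ext_det CARD('r) u = D * rho (phi.ext_det u)"
    using alternant_factors_through_phi[where 'r='r and 'n='n] by blast
  interpret rho: comm_ring_hom rho by fact
  have "u + ext_scale (- 1) v \<in> ext_power CARD('r)"
    using assms by (intro ext_power_add ext_power_scale)
  then have d: "u - v \<in> ext_power CARD('r)"
    by (simp only: ext_scale_minus_one diff_conv_add_uminus)
  have "alt.ext_det CARD('r) (u - v) = D * rho (phi.ext_det u - phi.ext_det v)"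
    by (simp only: bspec[OF rho(2) d] phi.ext_det_diff)
  also have "\<dots> = 0" by (simp add: assms(3))
  finally have "u - v = 0" by (rule alt_inj[OF d])
  then show ?thesis by simp
qed

section \<open>The action and the vertex operator\<close>

lemma Xwedge_mem: "Xwedge r lam \<in> ext_power r"
  unfolding Xwedge_def by (rule ext_power_wedge) simp

definition phi_inv :: "('r::enum, 'n::enum) rpoly \<Rightarrow> 'n base ext" where
  "phi_inv f = (SOME u. u \<in> ext_power CARD('r) \<and> phi.ext_det u = f)"

lemma phi_inv: "phi_inv f \<in> ext_power CARD('r)" "phi.ext_det (phi_inv f) = (f :: ('r::enum, 'n::enum) rpoly)"
  using someI_ex[of "\<lambda>u. u \<in> ext_power CARD('r) \<and> phi.ext_det u = f"] phi_surj[of f]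
  by (auto simp: phi_inv_def)

lemma phi_inv_eqI:
  assumes "u \<in> ext_power CARD('r)" "phi.ext_det u = (f :: ('r::enum, 'n::enum) rpoly)"
  shows "phi_inv f = u"
proof (rule phi_inj)
  show "phi.ext_det (phi_inv f) = (phi.ext_det u :: ('r, 'n) rpoly)"
    using phi_inv(2)[of f] assms(2) by simp
qed (fact phi_inv assms)+

lemma phi_inv_add: "phi_inv (f + g) = phi_inv f + phi_inv (g :: ('r::enum, 'n::enum) rpoly)"
  by (rule phi_inv_eqI) (simp_all add: ext_power_add phi_inv phi.ext_det_add)

lemma phi_inv_scale: "phi_inv (base_const a * f) = ext_scale a (phi_inv (f :: ('r::enum, 'n::enum) rpoly))"
  by (rule phi_inv_eqI) (simp_all add: ext_power_scale phi_inv phi.ext_det_scale)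

text \<open>
  Multiplication in \<open>B\<^sub>r(c)\<close>, transported through the bijection with the exterior power, has all
  the required properties.
\<close>

lemma is_action_action: "is_action (action :: ('r::enum, 'n::enum) rpoly \<Rightarrow> 'n base ext \<Rightarrow> 'n base ext)"
proof -
  define act where "act f u = phi_inv (f * phi.ext_det u)" for f :: "('r, 'n) rpoly" and u
  have W: "act f u \<in> ext_power CARD('r)" for f u
    unfolding act_def by (rule phi_inv)
  have phi: "phi.ext_det (act f u) = f * phi.ext_det u" for f u
    unfolding act_def by (rule phi_inv)
  have act_eqI: "act f u = v" if "v \<in> ext_power CARD('r)" "phi.ext_det v = f * phi.ext_det u" for f u v
    unfolding act_def using that by (rule phi_inv_eqI)
  have "is_action act"
    unfolding is_action_def Let_def
  proof (intro conjI allI ballI)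
    fix f g :: "('r, 'n) rpoly" and u v :: "'n base ext" and a i
    assume u: "u \<in> ext_power CARD('r)"
    show "act f u \<in> ext_power CARD('r)" by (rule W)
    show "act (f + g) u = act f u + act g u"
      by (rule act_eqI) (simp_all add: ext_power_add W phi phi.ext_det_add distrib_right)
    show "act (f * g) u = act f (act g u)"
      by (rule act_eqI) (simp_all add: W phi mult.assoc)
    show "act (base_const a) u = ext_scale a u"
      by (rule act_eqI) (simp_all add: ext_power_scale u phi.ext_det_scale)
    show "act (h_var i) u = sigma i u"
      by (rule act_eqI) (fact sigma_ext_power[OF u] phi_sigma[OF u])+
    assume v: "v \<in> ext_power CARD('r)"
    show "act f (u + v) = act f u + act f v"
      by (rule act_eqI) (simp_all add: ext_power_add W phi phi.ext_det_add distrib_left)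
  qed
  then show ?thesis unfolding action_def by (rule someI[where P = is_action])
qed

text \<open>
  The axioms fix an action on generators, and they hold for whichever action was chosen; so the
  determinantal map intertwines it with multiplication.
\<close>

lemma phi_action:
  assumes "u \<in> ext_power CARD('r)"
  shows "phi.ext_det (action f u) = (f :: ('r::enum, 'n::enum) rpoly) * phi.ext_det u"
proof -
  note A = is_action_action[where 'r='r and 'n='n, unfolded is_action_def Let_def]
  have W: "action f u \<in> ext_power CARD('r)" if "u \<in> ext_power CARD('r)" for f :: "('r, 'n) rpoly" and u
    using A that by blast
  have "\<forall>u\<in>ext_power CARD('r). phi.ext_det (action f u) = f * phi.ext_det u"
  proof (induction f rule: rpoly_generated)
    case (base a)
    have "action (base_const a :: ('r, 'n) rpoly) u = ext_scale a u" if "u \<in> ext_power CARD('r)" for u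
      using A that by blast
    then show ?case by (simp add: phi.ext_det_scale)
  next
    case (h i)
    have "action (h_var i :: ('r, 'n) rpoly) u = sigma i u" if "u \<in> ext_power CARD('r)" for u
      using A that by blast
    then show ?case using phi_sigma[where 'r='r and 'n='n] by simp
  next
    case (add f g)
    have "action (f + g) u = action f u + action g u" if "u \<in> ext_power CARD('r)" for u
      using A that by blast
    with add show ?case by (simp add: phi.ext_det_add distrib_right)
  next
    case (mult f g)
    have "action (f * g) u = action f (action g u)" if "u \<in> ext_power CARD('r)" for u
      using A that by blast
    with mult W show ?case by (simp add: mult.assoc)
  qed
  then show ?thesis using assms by blast
qed

text \<open>
  Since \<open>[X(c)]\<^sub>0\<close> corresponds to 1, the equation \<open>f [X(c)]\<^sub>0 = v\<close> has exactly one solution. This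
  is what makes the coefficients of the vertex operator well defined.
\<close>

lemma action_Xwedge_zero_eq_iff:
  assumes "v \<in> ext_power CARD('r)"
  shows "action f (Xwedge CARD('r) (\<lambda>_. 0)) = v \<longleftrightarrow> (f :: ('r::enum, 'n::enum) rpoly) = phi.ext_det v"
proof -
  have W: "action f (Xwedge CARD('r) (\<lambda>_. 0)) \<in> ext_power CARD('r)"
    using is_action_action[where 'r='r and 'n='n] Xwedge_mem unfolding is_action_def Let_def by blast
  have phi: "phi.ext_det (action f (Xwedge CARD('r) (\<lambda>_. 0))) = f"
    using phi_action[OF Xwedge_mem, of f "\<lambda>_. 0"] by (simp add: phi_Xwedge_zero)
  show ?thesis
    using phi phi_inj[OF W assms] by auto
qed

text \<open>
  Removing the staircase \<open>r-1, \<dots>, 1, 0\<close> from a strictly decreasing sequence leaves a partition.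
\<close>

lemma decreasing_list_partition:
  assumes dec: "sorted_wrt (>) as" and len: "length as = r"
  obtains lam where "antimono_on {1..r} lam" "as = map (\<lambda>j. r - j + lam j) [1..<r + 1]"
proof
  have gap: "i + d < r \<Longrightarrow> as ! (i + d) + d \<le> as ! i" for i d
  proof (induction d)
    case (Suc d)
    have "as ! (i + d) > as ! (i + Suc d)"
      using sorted_wrt_nth_less[OF dec, of "i + d" "i + Suc d"] Suc.prems len by simp
    then show ?case using Suc by simp
  qed simp
  define lam where "lam j = as ! (j - 1) - (r - j)" for j
  have big: "r - j \<le> as ! (j - 1)" if "1 \<le> j" "j \<le> r" for j
    using gap[of "j - 1" "r - j"] that by simp
  show "antimono_on {1..r} lam"
  proof (rule monotone_onI)
    fix x y assume xy: "x \<in> {1..r}" "y \<in> {1..r}" "x \<le> y"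
    have "as ! (y - 1) + (y - x) \<le> as ! (x - 1)"
      using gap[of "x - 1" "y - x"] xy by simp
    moreover have "r - x = (r - y) + (y - x)" using xy by simp
    ultimately show "lam y \<le> lam x" unfolding lam_def by arith
  qed
  show "as = map (\<lambda>j. r - j + lam j) [1..<r + 1]"
  proof (rule nth_equalityI)
    fix i assume "i < length as"
    then show "as ! i = map (\<lambda>j. r - j + lam j) [1..<r + 1] ! i"
      using big[of "Suc i"] len by (simp add: lam_def del: upt_Suc)
  qed (simp add: len del: upt_Suc)
qed

definition vertex_coeff :: "nat \<Rightarrow> nat \<Rightarrow> 'n::enum base ext \<Rightarrow> ('r::enum, 'n) rpoly" where
  "vertex_coeff i j u = phi.ext_det (wedge_left (monom 1 i) (contract j u))"

text \<open>
  Existence: the formula below is linear in \<open>\<phi>\<^sup>-\<^sup>1(f)\<close> for arbitrary \<open>f\<close>. Uniqueness: the \<open>\<Delta>\<^sub>\<lambda>\<close>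
  span \<open>B\<^sub>r(c)\<close> because the \<open>[X(c)]\<^sub>\<lambda>\<close> span the exterior power.
\<close>

lemma vertex_op_Delta:
  assumes lam: "antimono_on {1..CARD('r::enum)} lam"
  shows "fps_nth (fps_nth (vertex_op (Delta lam :: ('r, 'n::enum) rpoly)) i) j =
    vertex_coeff i j (Xwedge CARD('r) lam)"
proof -
  define E where "E f = Abs_fps (\<lambda>i. Abs_fps (\<lambda>j. vertex_coeff i j (phi_inv f) :: ('r, 'n) rpoly))"
    for f :: "('r, 'n) rpoly"
  have inv: "phi_inv (Delta lam :: ('r, 'n) rpoly) = Xwedge CARD('r) lam" for lam
    by (rule phi_inv_eqI[OF Xwedge_mem phi_Xwedge])
  have E_Delta: "fps_nth (fps_nth (E (Delta lam)) i) j = vertex_coeff i j (Xwedge CARD('r) lam)" for lam i j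
    by (simp add: E_def inv)
  have W: "wedge_left v (contract j (Xwedge CARD('r) lam)) \<in> (ext_power CARD('r) :: 'n base ext set)" for v j lam
    by (rule wedge_left_contract_ext_power[OF Xwedge_mem]) simp
  have op: "is_vertex_op E"
    unfolding is_vertex_op_def
  proof (intro conjI allI impI)
    fix f g show "E (f + g) = E f + E g"
      by (intro fps_ext) (simp add: E_def vertex_coeff_def phi_inv_add contract_add wedge_left_add phi.ext_det_add)
  next
    fix a f show "E (base_const a * f) = fps_const (fps_const (base_const a)) * E f"
      by (intro fps_ext)
        (simp add: E_def vertex_coeff_def phi_inv_scale contract_scale wedge_left_scale phi.ext_det_scale)
  next
    fix lam i j
    show "action (fps_nth (fps_nth (E (Delta lam)) i) j) (Xwedge CARD('r) (\<lambda>_. 0)) =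
           wedge_left (monom 1 i) (contract j (Xwedge CARD('r) lam))"
      unfolding action_Xwedge_zero_eq_iff[OF W] E_Delta vertex_coeff_def ..
  qed
  have "E' = E" if op': "is_vertex_op E'" for E'
  proof
    fix f :: "('r, 'n) rpoly"
    have add: "E' (f + g) = E' f + E' g" for f g
      using op' unfolding is_vertex_op_def by blast
    have scale: "E' (base_const a * f) = fps_const (fps_const (base_const a)) * E' f" for a f
      using op' unfolding is_vertex_op_def by blast
    have E_add: "E (f + g) = E f + E g" for f g
      using op unfolding is_vertex_op_def by blast
    have E_scale: "E (base_const a * f) = fps_const (fps_const (base_const a)) * E f" for a f
      using op unfolding is_vertex_op_def by blast
    have "E' (phi.ext_det (phi_inv f)) = E (phi.ext_det (phi_inv f))"
    proof (rule ext_power_span[where p = Xc and P = "\<lambda>u. E' (phi.ext_det u) = E (phi.ext_det u)",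
            OF coeff_Xc_top degree_Xc])
      show "E' (phi.ext_det 0) = E (phi.ext_det 0)"
        using add[of 0 0] E_add[of 0 0] by (simp add: phi.ext_det_zero)
    next
      fix as :: "nat list" assume as: "sorted_wrt (>) as" "length as = CARD('r)"
      then obtain lam where lam: "antimono_on {1..CARD('r)} lam" "as = map (\<lambda>j. CARD('r) - j + lam j) [1..<CARD('r) + 1]"
        by (rule decreasing_list_partition)
      then have w: "wedge (map Xc as) = (Xwedge CARD('r) lam :: 'n base ext)"
        by (simp add: Xwedge_def comp_def del: upt_Suc)
      have "fps_nth (fps_nth (E' (Delta lam)) i) j = fps_nth (fps_nth (E (Delta lam)) i) j" for i j
      proof -
        have "action (fps_nth (fps_nth (E' (Delta lam)) i) j) (Xwedge CARD('r) (\<lambda>_. 0)) =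
           wedge_left (monom 1 i) (contract j (Xwedge CARD('r) lam))"
          using op' lam(1) unfolding is_vertex_op_def by blast
        then show ?thesis unfolding action_Xwedge_zero_eq_iff[OF W] E_Delta vertex_coeff_def .
      qed
      then have "E' (Delta lam) = E (Delta lam)" by (intro fps_ext)
      then show "E' (phi.ext_det (wedge (map Xc as))) = E (phi.ext_det (wedge (map Xc as)))"
        unfolding w phi_Xwedge .
    next
      show "phi_inv f \<in> ext_power CARD('r)" by (rule phi_inv)
    qed (simp_all only: phi.ext_det_add phi.ext_det_scale add scale E_add E_scale)
    then show "E' f = E f" by (simp only: phi_inv)
  qed
  then have vertex_op_eq: "vertex_op = E"
    unfolding vertex_op_def using op by (intro the_equality)
  show ?thesis unfolding vertex_op_eq by (rule E_Delta)
qed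

section \<open>The determinantal formula\<close>

text \<open>
  Subtract \<open>z\<^sup>-\<^sup>1\<close> times row \<open>m - 1\<close> from row \<open>m\<close>, that is, multiply by the unitriangular matrix
  \<open>T\<close>. This clears the column of powers of \<open>z\<close> except for its top entry, and the operation it
  performs on the other columns is \<open>\<sigma>\<^sub>-(z)\<close>.
\<close>

lemma det_bordered_powers:
  fixes z zi :: "'a::comm_ring_1" and f :: "nat \<Rightarrow> nat \<Rightarrow> 'a"
  assumes z: "z * zi = 1"
  shows "Determinant.det (mat (Suc l) (Suc l) (\<lambda>(m, k). if k = 0 then z ^ (l - m) else f m (k - 1))) =
    z ^ l * Determinant.det (mat l l (\<lambda>(m, k). f (Suc m) k - f m k * zi))"
proof -
  define G where "G = mat (Suc l) (Suc l) (\<lambda>(m, k). if k = 0 then z ^ (l - m) else f m (k - 1))"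
  define T where "T = mat (Suc l) (Suc l) (\<lambda>(m, k). if k = m then 1 else if m = Suc k then - zi else 0)"
  have [simp]: "G \<in> carrier_mat (Suc l) (Suc l)" "T \<in> carrier_mat (Suc l) (Suc l)"
    by (simp_all add: G_def T_def)
  have "Determinant.det T = prod_list (diag_mat T)"
    by (rule det_lower_triangular[where n = "Suc l"]) (auto simp: T_def)
  then have T1: "Determinant.det T = 1" by (simp add: prod_list_diag_prod T_def)
  define P where "P = T * G"
  have "P \<in> carrier_mat (Suc l) (Suc l)"
    unfolding P_def by (rule mult_carrier_mat[where n = "Suc l"]) simp_all
  then have P [simp]: "P \<in> carrier_mat (Suc l) (Suc l)" "dim_row P = Suc l" "dim_col P = Suc l"
    by auto
  have P_entry: "P $$ (m, k) = (\<Sum>i<Suc l. T $$ (m, i) * G $$ (i, k))" if "m \<le> l" "k \<le> l" for m k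
    using that by (simp add: P_def T_def G_def scalar_prod_def lessThan_atLeast0 del: sum.op_ivl_Suc)
  have P_0: "P $$ (0, k) = G $$ (0, k)" if "k \<le> l" for k
  proof -
    have "P $$ (0, k) = (\<Sum>i\<in>{0}. T $$ (0, i) * G $$ (i, k))"
      unfolding P_entry[OF le0 that] by (rule sum.mono_neutral_right) (auto simp: T_def)
    then show ?thesis by (simp add: T_def)
  qed
  have P_Suc: "P $$ (Suc m, k) = G $$ (Suc m, k) - zi * G $$ (m, k)" if "m < l" "k \<le> l" for m k
  proof -
    have "P $$ (Suc m, k) = (\<Sum>i\<in>{m, Suc m}. T $$ (Suc m, i) * G $$ (i, k))"
      unfolding P_entry[OF Suc_leI[OF that(1)] that(2)]
      by (rule sum.mono_neutral_right) (use that in \<open>auto simp: T_def\<close>)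
    then show ?thesis using that by (simp add: T_def)
  qed
  have P_col: "P $$ (m, 0) = (if m = 0 then z ^ l else 0)" if m: "m \<le> l" for m
  proof (cases m)
    case 0
    then show ?thesis unfolding 0 by (simp add: P_0) (simp add: G_def)
  next
    case (Suc m')
    then have "l - m' = Suc (l - Suc m')" using m by simp
    then have "zi * z ^ (l - m') = (z * zi) * z ^ (l - Suc m')" by (simp add: mult_ac)
    then show ?thesis using Suc m P_Suc[of m' 0] by (simp add: G_def z)
  qed
  have minor: "mat_delete P 0 0 = mat l l (\<lambda>(m, k). f (Suc m) k - f m k * zi)"
  proof (rule eq_matI)
    fix m k assume "m < dim_row (mat l l (\<lambda>(m, k). f (Suc m) k - f m k * zi))"
      "k < dim_col (mat l l (\<lambda>(m, k). f (Suc m) k - f m k * zi))"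
    then have mk: "m < l" "k < l" by simp_all
    then have "mat_delete P 0 0 $$ (m, k) = P $$ (Suc m, Suc k)" by (simp add: mat_delete_def)
    also have "\<dots> = f (Suc m) k - f m k * zi"
      using mk by (simp add: P_Suc) (simp add: G_def mult.commute)
    finally show "mat_delete P 0 0 $$ (m, k) = mat l l (\<lambda>(m, k). f (Suc m) k - f m k * zi) $$ (m, k)"
      using mk by simp
  qed (simp_all add: mat_delete_def)
  have "Determinant.det G = Determinant.det P"
    by (simp add: P_def det_mult[where n = "Suc l"] T1)
  also have "\<dots> = (\<Sum>i<Suc l. P $$ (i, 0) * cofactor P i 0)"
    by (rule laplace_expansion_column) auto
  also have "\<dots> = (\<Sum>i\<in>{0}. P $$ (i, 0) * cofactor P i 0)"
    by (rule sum.mono_neutral_right) (auto simp: P_col)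
  also have "\<dots> = z ^ l * Determinant.det (mat l l (\<lambda>(m, k). f (Suc m) k - f m k * zi))"
    by (simp add: P_col cofactor_def minor)
  finally show ?thesis unfolding G_def .
qed

text \<open>
  The identity is derived between double power series and transported to Laurent series, where
  \<open>z\<^sup>-\<^sup>1\<close> and \<open>w\<close> exist, along a ring homomorphism.
\<close>

lemma fps_to_fls_hom: "comm_ring_hom (fps_to_fls :: 'a::comm_ring_1 fps \<Rightarrow> 'a fls)"
  by unfold_locales (simp_all add: fls_times_fps_to_fls)

interpretation zw: comm_ring_hom "laurent_of_zw :: 'a::comm_ring_1 fps fps \<Rightarrow> 'a laurent"
proof
  interpret F: comm_ring_hom "fps_to_fls :: 'a fps \<Rightarrow> 'a fls" by (rule fps_to_fls_hom)
  interpret G: comm_ring_hom "fps_to_fls :: 'a fls fps \<Rightarrow> 'a laurent" by (rule fps_to_fls_hom)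
  let ?J = "\<lambda>F :: 'a fps fps. Abs_fps (\<lambda>i. fps_to_fls (fps_nth F i))"
  fix A B :: "'a fps fps"
  have "?J (A + B) = ?J A + ?J B" by (rule fps_ext) (simp add: F.hom_add)
  then show "laurent_of_zw (A + B) = laurent_of_zw A + laurent_of_zw B"
    unfolding laurent_of_zw_def by (simp only: G.hom_add)
  have "?J (A * B) = ?J A * ?J B" by (rule fps_ext) (simp add: fps_mult_nth F.hom_sum F.hom_mult)
  then show "laurent_of_zw (A * B) = laurent_of_zw A * laurent_of_zw B"
    unfolding laurent_of_zw_def by (simp only: G.hom_mult)
  have "?J 0 = 0" by (rule fps_ext) simp
  then show "laurent_of_zw (0 :: 'a fps fps) = 0"
    unfolding laurent_of_zw_def by (simp only: G.hom_zero)
  have "?J 1 = 1" by (rule fps_ext) simp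
  then show "laurent_of_zw (1 :: 'a fps fps) = 1"
    unfolding laurent_of_zw_def by (simp only: G.hom_one)
qed

lemma zw_const: "laurent_of_zw (fps_const F) = fls_const (fps_to_fls F)"
proof -
  have "Abs_fps (\<lambda>i. fps_to_fls (fps_nth (fps_const F) i)) = fps_const (fps_to_fls F)"
    by (rule fps_ext) simp
  then show ?thesis by (simp add: laurent_of_zw_def)
qed

lemma zw_lconst: "laurent_of_zw (fps_const (fps_const a)) = lconst a"
  by (simp add: zw_const lconst_def)

lemma zw_X: "laurent_of_zw fps_X = z_var"
proof -
  have "Abs_fps (\<lambda>i. fps_to_fls (fps_nth (fps_X :: 'a fps fps) i)) = fps_X"
    by (rule fps_ext) (simp add: fps_X_def)
  then show ?thesis by (simp add: laurent_of_zw_def z_var_def fps_X_to_fls)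
qed

lemma zw_w: "laurent_of_zw (fps_const fps_X) = w_inv"
  by (simp add: zw_const w_inv_def fps_X_to_fls)

lemma zw_z_series: "laurent_of_zw (Abs_fps (\<lambda>i. fps_const (fps_nth F i))) = laurent_of_z F"
  by (simp add: laurent_of_zw_def laurent_of_z_def)

lemma zw_w_poly: "laurent_of_zw (fps_const (Abs_fps (\<lambda>j. base_const (coeff (Xc m) j)))) = 
    (w_inv_c m :: ('r::enum, 'n::enum) rpoly laurent)"
proof -
  let ?p = "Xc m :: 'n base poly"
  let ?c = "\<lambda>j. base_const (coeff ?p j) :: ('r, 'n) rpoly"
  interpret C: comm_ring_hom "fps_const :: ('r, 'n) rpoly fps \<Rightarrow> _"
    by unfold_locales (simp_all flip: fps_const_add fps_const_mult)
  have "Abs_fps ?c = (\<Sum>j\<le>degree ?p. fps_const (?c j) * fps_X ^ j)"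
  proof (rule fps_ext)
    fix n
    have "fps_nth (\<Sum>j\<le>degree ?p. fps_const (?c j) * fps_X ^ j) n = (\<Sum>j\<le>degree ?p. if n = j then ?c j else 0)"
      unfolding fps_sum_nth by (rule sum.cong) auto
    also have "\<dots> = ?c n" by (cases "n \<le> degree ?p") (auto simp: coeff_eq_0 phi.hom_zero)
    finally show "fps_nth (Abs_fps ?c) n = fps_nth (\<Sum>j\<le>degree ?p. fps_const (?c j) * fps_X ^ j) n" by simp
  qed
  then have "laurent_of_zw (fps_const (Abs_fps ?c)) = (\<Sum>j\<le>degree ?p. lconst (?c j) * w_inv ^ j)"
    by (simp only: C.hom_sum C.hom_mult C.hom_power zw.hom_sum zw.hom_mult zw.hom_power zw_lconst zw_w)
  also have "\<dots> = (\<Sum>j\<le>degree ?p. coeff (map_poly (\<lambda>a. lconst (base_const a)) ?p) j * w_inv ^ j)"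
    by (subst coeff_map_poly) (simp_all add: lconst_def)
  also have "\<dots> = poly (map_poly (\<lambda>a. lconst (base_const a)) ?p) w_inv"
    unfolding poly_altdef
    by (rule sum.mono_neutral_right) (use map_poly_degree_leq in \<open>auto simp: coeff_eq_0\<close>)
  finally show ?thesis unfolding w_inv_c_def .
qed

lemma lconst_hom: "comm_ring_hom (lconst :: 'a::comm_ring_1 \<Rightarrow> 'a laurent)"
  by unfold_locales (simp_all add: zw_lconst[symmetric] zw.hom_add[symmetric] zw.hom_mult[symmetric])

lemma fls_X_mult_inv: "fls_X * fls_X_inv = (1 :: 'a::comm_ring_1 fls)"
  by (simp add: fls_X_times_conv_shift)

lemma z_var_inv: "z_var * z_inv = 1"
  unfolding z_var_def z_inv_def by (rule fls_X_mult_inv)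
lemma w_inv_var: "w_inv * w_var = 1"
  unfolding w_var_def w_inv_def by (simp add: fls_const_mult_const fls_X_mult_inv)

text \<open>
  With \<open>a\<^sub>j = r - j + \<lambda>\<^sub>j\<close>, contraction and expansion of the determinant along the new first
  column \<open>h\<^bsub>i-r+m\<^esub>\<close> give a sum over the removed letter \<open>j\<close> and the row \<open>m\<close>. Its generating
  function separates into \<open>w\<^bsup>-a\<^sub>j\<^esup>(c)\<close>, the series \<open>\<Sum>\<^sub>i h\<^bsub>i-r+m\<^esub> z\<^sup>i = z\<^bsup>r-m\<^esup>/E\<^sub>r(z)\<close> and a
  cofactor. The sum over \<open>m\<close> is a determinant bordered by powers of \<open>z\<close>, and the sum over \<open>j\<close> is
  the expansion of the determinant of the theorem along its first row. In the proof rows and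
  columns are counted from 0, so \<open>l = r - 1\<close> is the last index.
\<close>

theorem theorem3p15:
  fixes lam :: "nat \<Rightarrow> nat"
  assumes "antimono_on {1..CARD('r::enum)} lam"
  shows "laurent_of_zw (vertex_op (Delta lam :: ('r, 'n::enum) rpoly)) =
    z_var ^ (CARD('r) - 1) * w_inv ^ (CARD('r) - 1) * laurent_of_z E_inv * Delta_w lam"
proof -
  interpret lconst: comm_ring_hom "lconst :: ('r, 'n) rpoly \<Rightarrow> _" by (rule lconst_hom)
  define l where "l = CARD('r) - 1"
  have r: "CARD('r) = Suc l" by (simp add: l_def)
  have rows: "{..<CARD('r)} = {..<Suc l}" by (simp add: r)
  \<comment> \<open>\<open>e j\<close> is the degree of the \<open>j\<close>-th letter and \<open>ws j\<close> is the word without it.\<close>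
  define e where "e j = Suc l - (j + 1) + lam (j + 1)" for j
  define vs :: "'n base poly list" where "vs = map (\<lambda>j. Xc (e j)) [0..<Suc l]"
  define ws where "ws j = take j vs @ drop (Suc j) vs" for j
  have len: "length vs = Suc l" by (simp add: vs_def)
  have vs_nth: "vs ! j = Xc (e j)" if "j < Suc l" for j using that by (simp add: vs_def del: upt_Suc)
  have len_ws: "length (ws j) = l" if "j < Suc l" for j using that by (simp add: ws_def len)
  have ws_nth: "ws j ! k = vs ! (if k < j then k else Suc k)" if "j < Suc l" "k < l" for j k
    using that by (auto simp: ws_def nth_append len)
  have Xw: "Xwedge CARD('r) lam = wedge vs"
    unfolding Xwedge_def vs_def r e_def
    by (rule arg_cong[where f = wedge], rule nth_equalityI) (simp_all del: upt_Suc)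
  \<comment> \<open>The cofactor of the \<open>m\<close>-th entry of the first column, once the letter \<open>j\<close> is replaced by a new first letter.\<close>
  define K :: "nat \<Rightarrow> nat \<Rightarrow> ('r, 'n) rpoly" where "K j m = cofactor (phi.form_mat (0 # ws j)) m 0" for j m
  have coeff: "vertex_coeff i t (wedge vs) =
     (\<Sum>j<Suc l. \<Sum>m<Suc l. (- 1) ^ j * K j m * base_const (coeff (Xc (e j)) t) * h_row m i)" for i t
  proof -
    have "phi.word_det (monom 1 i # ws j) = (\<Sum>m<Suc l. h_row m i * K j m)" if "j < Suc l" for j
    proof -
      have "phi.word_det ([] @ monom 1 i # ws j) =
          (\<Sum>m<CARD('r). phi.form m (monom 1 i) * cofactor (phi.form_mat ([] @ 0 # ws j)) m (length ([] :: 'n base poly list)) :: ('r, 'n) rpoly)"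
        by (rule phi.word_det_column) (simp add: len_ws[OF that] r)
      then show ?thesis unfolding rows K_def by (simp add: phi.form_monom phi.hom_one)
    qed
    then show ?thesis
      unfolding vertex_coeff_def contract_wedge len
      by (auto simp: wedge_left_sum wedge_left_scale wedge_left_wedge phi.ext_det_sum phi.ext_det_scale
          phi.ext_det_wedge phi.hom_mult phi.hom_power phi.hom_uminus ws_def[symmetric] vs_nth sum_distrib_left mult_ac
          intro!: sum.cong simp del: sum.lessThan_Suc)
  qed
  let ?W = "\<lambda>j. fps_const (Abs_fps (\<lambda>t. base_const (coeff (Xc (e j)) t))) :: ('r, 'n) rpoly fps fps"
  let ?Z = "Abs_fps (\<lambda>i. fps_const (fps_nth E_inv i)) :: ('r, 'n) rpoly fps fps"
  have Z: "fps_nth (fps_X ^ (l - m) * ?Z) i = fps_const (h_row m i)" if "m < Suc l" for m i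
    using that by (auto simp: fps_X_power_mult_nth h_row_def h_at_def h_var_def r nat_diff_distrib
        intro!: arg_cong[where f = fps_const] arg_cong[where f = "fps_nth E_inv"])
  have "vertex_op (Delta lam :: ('r, 'n) rpoly) =
    (\<Sum>j<Suc l. \<Sum>m<Suc l. fps_const (fps_const ((- 1) ^ j * K j m)) * ?W j * (fps_X ^ (l - m) * ?Z))"
    by (intro fps_ext)
      (simp add: vertex_op_Delta[OF assms] Xw coeff fps_sum_nth mult.assoc Z del: sum.lessThan_Suc)
  then have "laurent_of_zw (vertex_op (Delta lam :: ('r, 'n) rpoly)) =
    (\<Sum>j<Suc l. \<Sum>m<Suc l. lconst ((- 1) ^ j * K j m) * w_inv_c (e j) * (z_var ^ (l - m) * laurent_of_z E_inv))"
    by (simp only: zw.hom_sum zw.hom_mult zw.hom_power zw_X zw_lconst zw_w_poly zw_z_series)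
  also have "\<dots> = laurent_of_z E_inv *
      (\<Sum>j<Suc l. w_inv_c (e j) * ((- 1) ^ j * (\<Sum>m<Suc l. z_var ^ (l - m) * lconst (K j m))))"
    by (simp add: sum_distrib_left lconst.hom_mult lconst.hom_power lconst.hom_uminus mult_ac del: sum.lessThan_Suc)
  also have "(\<Sum>j<Suc l. w_inv_c (e j) * ((- 1) ^ j * (\<Sum>m<Suc l. z_var ^ (l - m) * lconst (K j m)))) =
      z_var ^ l * det1 (Suc l) (\<lambda>k j. if k = 1 then w_inv_c (Suc l - j + lam j)
        else sigma_minus_hc (int (lam j) - int j + int k) :: ('r, 'n) rpoly laurent)"
  proof -
    define M :: "('r, 'n) rpoly laurent mat" where "M = mat (Suc l) (Suc l) (\<lambda>(k, j). if k = 0 then w_inv_c (e j)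
        else lconst (phi.form k (vs ! j)) - lconst (phi.form (k - 1) (vs ! j)) * z_inv)"
    let ?N = "mat (Suc l) (Suc l) (\<lambda>(k, j). if k + 1 = 1 then w_inv_c (Suc l - (j + 1) + lam (j + 1))
        else sigma_minus_hc (int (lam (j + 1)) - int (j + 1) + int (k + 1))) ::
        ('r, 'n) rpoly laurent mat"
    have M: "M = ?N"
    proof (rule eq_matI)
      fix k j assume "k < dim_row ?N" "j < dim_col ?N"
      then have kj: "k < Suc l" "j < Suc l" by simp_all
      have idx: "int (e j) + int k + 1 - int CARD('r) = int (lam (j + 1)) - int (j + 1) + int (k + 1)"
        using kj by (simp add: e_def r of_nat_diff)
      show "M $$ (k, j) = ?N $$ (k, j)"
      proof (cases k)
        case 0 then show ?thesis using kj by (simp add: M_def e_def)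
      next
        case (Suc k')
        have "phi.form k (vs ! j) = (hc (int (lam (j + 1)) - int (j + 1) + int (k + 1)) :: ('r, 'n) rpoly)"
          using kj unfolding vs_nth[OF kj(2)] idx[symmetric] by (intro phi_form_Xc) (simp add: r)
        moreover have "phi.form k' (vs ! j) = (hc (int (lam (j + 1)) - int (j + 1) + int (k + 1) - 1) :: ('r, 'n) rpoly)"
          using kj Suc unfolding vs_nth[OF kj(2)] idx[symmetric] by (subst phi_form_Xc) (simp_all add: r)
        ultimately show ?thesis using kj Suc by (simp add: M_def sigma_minus_hc_def)
      qed
    qed (simp_all add: M_def)
    \<comment> \<open>Both sides are the determinant bordered by the powers of \<open>z\<close>: the left side after clearing that
    column, the right side expanded along it.\<close>
    have minor: "z_var ^ l * Determinant.det (mat_delete M 0 j) = (\<Sum>m<Suc l. z_var ^ (l - m) * lconst (K j m))"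
      if j: "j < Suc l" for j
    proof -
      let ?f = "\<lambda>m k. lconst (phi.form m (ws j ! k)) :: ('r, 'n) rpoly laurent"
      let ?G = "mat (Suc l) (Suc l) (\<lambda>(m, k). if k = 0 then z_var ^ (l - m) else ?f m (k - 1))"
      have "mat_delete M 0 j = mat l l (\<lambda>(m, k). ?f (Suc m) k - ?f m k * z_inv)"
        by (rule eq_matI) (use j in \<open>auto simp: mat_delete_def M_def ws_nth\<close>)
      then have "z_var ^ l * Determinant.det (mat_delete M 0 j) = Determinant.det ?G"
        using det_bordered_powers[OF z_var_inv, of l ?f] by simp
      also have "\<dots> = (\<Sum>m<Suc l. ?G $$ (m, 0) * cofactor ?G m 0)"
        by (rule laplace_expansion_column) auto
      also have "\<dots> = (\<Sum>m<Suc l. z_var ^ (l - m) * lconst (K j m))"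
      proof (rule sum.cong[OF refl])
        fix m assume m: "m \<in> {..<Suc l}"
        have "mat_delete ?G m 0 = map_mat lconst (mat_delete (phi.form_mat (0 # ws j)) m 0)"
          unfolding phi.form_mat_def by (rule eq_matI) (auto simp: mat_delete_def r)
        then have "cofactor ?G m 0 = lconst (K j m)"
          by (simp add: cofactor_def K_def lconst.hom_mult lconst.hom_power lconst.hom_uminus)
        then show "?G $$ (m, 0) * cofactor ?G m 0 = z_var ^ (l - m) * lconst (K j m)"
          using m by simp
      qed
      finally show ?thesis .
    qed
    have "z_var ^ l * Determinant.det M = z_var ^ l * (\<Sum>j<Suc l. M $$ (0, j) * cofactor M 0 j)"
      by (subst laplace_expansion_row[of M "Suc l" 0]) (simp_all add: M_def)
    also have "\<dots> = (\<Sum>j<Suc l. M $$ (0, j) * ((- 1) ^ j * (z_var ^ l * Determinant.det (mat_delete M 0 j))))"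
      by (simp add: sum_distrib_left cofactor_def mult_ac del: sum.lessThan_Suc)
    also have "\<dots> = (\<Sum>j<Suc l. w_inv_c (e j) * ((- 1) ^ j * (\<Sum>m<Suc l. z_var ^ (l - m) * lconst (K j m))))"
    proof (rule sum.cong[OF refl])
      fix j assume "j \<in> {..<Suc l}"
      then have j: "j < Suc l" by simp
      have "M $$ (0, j) = w_inv_c (e j)" using j by (simp add: M_def)
      then show "M $$ (0, j) * ((- 1) ^ j * (z_var ^ l * Determinant.det (mat_delete M 0 j))) =
          w_inv_c (e j) * ((- 1) ^ j * (\<Sum>m<Suc l. z_var ^ (l - m) * lconst (K j m)))"
        by (simp only: minor[OF j])
    qed
    finally show ?thesis unfolding det1_def M[symmetric] by simp
  qed
  \<comment> \<open>The factors \<open>w\<^bsup>-(r-1)\<^esup>\<close> and \<open>w\<^bsup>r-1\<^esup>\<close> of the statement cancel.\<close>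
  also have "laurent_of_z E_inv * (z_var ^ l * det1 (Suc l) (\<lambda>k j. if k = 1 then w_inv_c (Suc l - j + lam j)
        else sigma_minus_hc (int (lam j) - int j + int k) :: ('r, 'n) rpoly laurent)) =
      z_var ^ l * (w_inv * w_var) ^ l * laurent_of_z E_inv * det1 (Suc l) (\<lambda>k j. if k = 1 then w_inv_c (Suc l - j + lam j)
        else sigma_minus_hc (int (lam j) - int j + int k))"
    by (simp add: w_inv_var mult_ac)
  also have "\<dots> = z_var ^ (CARD('r) - 1) * w_inv ^ (CARD('r) - 1) * laurent_of_z E_inv * Delta_w lam"
    unfolding Delta_w_def r by (simp add: power_mult_distrib mult_ac)
  finally show ?thesis .
qed

end
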